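(* Let $s:\mathbb{R}\to\mathbb{R}^3$ be a sufficiently smooth regular space curve, let $u,\varepsilon\in\mathbb{R}$ with $\kappa(u)\neq 0$, and let $\gamma:\mathbb{Z}\to\mathbb{R}^3$ be the discrete curve $\gamma_k=\gamma(k)=s(u+(2k-1)\varepsilon)$. Let $\kappa(u)$ and $N(u)$ be the curvature and the principal unit normal of $s$ at $u$, and let $\kappa_0$ and $m_0$ be the inverse radius and the center of the discrete curvature circle $k_0$ of $\gamma$ at the edge $\gamma_0\gamma_1$. Then, as $\varepsilon\to0$ (with $\varepsilon\ne0$): (1) $\kappa_0=|\kappa(u)|+O(\varepsilon^2)$; (2) $m_0=s(u)+\frac{1}{\kappa(u)}N(u)+O(\varepsilon^2)$; (3) $p_{\gamma_0\gamma_1}=f(\gamma_{-1},\gamma_0,\gamma_1,\gamma_2)=s(u)+O(\varepsilon^3)$.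
   Context: Regular means $s'\neq0$ everywhere; sufficiently smooth means of class $C^k$ with $k$ large enough. Smooth curvature: $\kappa=\|s'\times s''\|/\|s'\|^3$; the principal normal is $N=B\times T$ with $T=s'/\|s'\|$, $B=(s'\times s'')/\|s'\times s''\|$. Quaternions are written $[r,v]$ with $r\in\mathbb{R}$, $v\in\mathbb{R}^3$, with product $[r,v][s,w]=[rs-\langle v,w\rangle,\,rw+sv+v\times w]$, and $\mathbb{R}^3$ is identified with the imaginary quaternions $\mathrm{Im}\,\mathbb{H}$ via $v\leftrightarrow[0,v]$. For $q=|q|[\cos\phi,v\sin\phi]$ with $\|v\|=1$, $\phi\in[0,\pi]$, set $\sqrt q=\sqrt{|q|}\,[\cos\frac\phi2,v\sin\frac\phi2]$ (well defined unless $q$ is a negative real). The cross-ratio is $\mathrm{cr}(a,b,c,d)=(a-b)(b-c)^{-1}(c-d)(d-a)^{-1}$. For pairwise distinct $a,b,c,d\in\mathrm{Im}\,\mathbb{H}$ with $\mathrm{cr}(c,a,b,d)\notin\mathbb{R}_{<0}$ set $$f(a,b,c,d)=\big((b-a)(c-a)^{-1}\sqrt{\mathrm{cr}(c,a,b,d)}+1\big)^{-1}\big((b-a)(c-a)^{-1}\sqrt{\mathrm{cr}(c,a,b,d)}\,c+b\big),$$ (with value $\infty$ if the first factor is not invertible before inversion); this is a point of $\mathbb{R}^3\cup\{\infty\}$. For a discrete curve $\gamma:\mathbb{Z}\to\mathbb{R}^3$ and $(a,b,c,d)=(\gamma_{i-1},\gamma_i,\gamma_{i+1},\gamma_{i+2})$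 put $p_{ab}=f(d,a,b,c)$, $p_{bc}=f(a,b,c,d)$, $p_{cd}=f(b,c,d,a)$, $p_{da}=f(c,d,a,b)$ (the occurring cross-ratios are assumed not to be negative real numbers, which, for $i=0$, holds for the samples $\gamma_k=s(u+(2k-1)\varepsilon)$, $k\in\mathbb{Z}$, of a sufficiently smooth regular space curve $s:\mathbb{R}\to\mathbb{R}^3$ for small $\varepsilon\neq0$). These four points lie on a common circle (or line) $k_i$, called the discrete curvature circle at the edge $\gamma_i\gamma_{i+1}$; the discrete curvature $\kappa_i$ is the inverse of its radius. One writes $p_{\gamma_i\gamma_{i+1}}=p_{bc}$. *)

theory Defs
  imports "HOL-Analysis.Analysis" "HOL-Library.Landau_Symbols"
begin

section \<open>Space curves\<close>

definition iter_deriv :: "nat \<Rightarrow> (real \<Rightarrow> real^3) \<Rightarrow> real \<Rightarrow> real^3" where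
  "iter_deriv n s = ((\<lambda>g t. vector_derivative g (at t)) ^^ n) s"

definition C_k_curve :: "nat \<Rightarrow> (real \<Rightarrow> real^3) \<Rightarrow> bool" where
  "C_k_curve k s \<longleftrightarrow>
     (\<forall>j<k. \<forall>t. iter_deriv j s differentiable (at t)) \<and> continuous_on UNIV (iter_deriv k s)"

definition regular_curve :: "(real \<Rightarrow> real^3) \<Rightarrow> bool" where
  "regular_curve s \<longleftrightarrow> (\<forall>t. iter_deriv 1 s t \<noteq> 0)"

definition curvature :: "(real \<Rightarrow> real^3) \<Rightarrow> real \<Rightarrow> real" where
  "curvature s t = norm (cross3 (iter_deriv 1 s t) (iter_deriv 2 s t)) / norm (iter_deriv 1 s t) ^ 3"

definition unit_tangent :: "(real \<Rightarrow> real^3) \<Rightarrow> real \<Rightarrow> real^3" where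
  "unit_tangent s t = iter_deriv 1 s t /\<^sub>R norm (iter_deriv 1 s t)"

definition unit_binormal :: "(real \<Rightarrow> real^3) \<Rightarrow> real \<Rightarrow> real^3" where
  "unit_binormal s t =
     (let b = cross3 (iter_deriv 1 s t) (iter_deriv 2 s t) in b /\<^sub>R norm b)"

definition principal_normal :: "(real \<Rightarrow> real^3) \<Rightarrow> real \<Rightarrow> real^3" where
  "principal_normal s t = cross3 (unit_binormal s t) (unit_tangent s t)"

section \<open>Quaternions\<close>

datatype quat = Quat (scal: real) (vect: "real^3")

lemma quat_eq_iff: "p = q \<longleftrightarrow> scal p = scal q \<and> vect p = vect q"
  by (cases p; cases q) simp

instantiation quat :: real_normed_div_algebra
begin

definition "0 = Quat 0 0"

definition "1 = Quat 1 0"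

definition "p + q = Quat (scal p + scal q) (vect p + vect q)"

definition "- p = Quat (- scal p) (- vect p)"

definition "p - q = Quat (scal p - scal q) (vect p - vect q)"

definition scaleR_quat_def: "c *\<^sub>R p = Quat (c * scal p) (c *\<^sub>R vect p)"

definition "p * q = Quat (scal p * scal q - vect p \<bullet> vect q)
   (scal p *\<^sub>R vect q + scal q *\<^sub>R vect p + cross3 (vect p) (vect q))"

definition norm_quat_def: "norm p = sqrt ((scal p)\<^sup>2 + (norm (vect p))\<^sup>2)"

definition inverse_quat_def: "inverse p = Quat (scal p / (norm p)\<^sup>2) (- vect p /\<^sub>R (norm p)\<^sup>2)"

definition divide_quat_def: "p div q = p * inverse (q::quat)"

definition sgn_quat_def: "sgn p = inverse (norm p) *\<^sub>R (p::quat)"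

definition dist_quat_def: "dist p q = norm (p - q :: quat)"

definition uniformity_quat_def [code del]:
  "(uniformity :: (quat \<times> quat) filter) = (INF e\<in>{0 <..}. principal {(x, y). dist x y < e})"

definition open_quat_def [code del]:
  "open (U :: quat set) \<longleftrightarrow> (\<forall>x\<in>U. eventually (\<lambda>(x', y). x' = x \<longrightarrow> y \<in> U) uniformity)"

lemma quat_inverse_aux:
  fixes p :: quat
  assumes "p \<noteq> 0"
  shows "inverse p * p = 1" "p * inverse p = 1"
proof -
  have "(scal p)\<^sup>2 + (norm (vect p))\<^sup>2 \<noteq> 0"
    using assms unfolding sum_power2_eq_zero_iff by (simp add: zero_quat_def quat_eq_iff)
  then have *: "scal p * scal p + vect p \<bullet> vect p \<noteq> 0"
    by (simp only: power2_norm_eq_inner power2_eq_square[of "scal p"] not_False_eq_True)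
  have n: "(norm p)\<^sup>2 = scal p * scal p + vect p \<bullet> vect p"
    by (simp add: norm_quat_def dot_square_norm power2_eq_square)
  show "inverse p * p = 1" "p * inverse p = 1"
    unfolding inverse_quat_def n times_quat_def one_quat_def scaleR_quat_def
    using * by (simp_all add: quat_eq_iff cross_mult_left cross_mult_right cross_minus_left
        cross_minus_right divide_simps)
qed

instance
proof
  fix a b c p q r :: quat and x y :: real
  show "a + b + c = a + (b + c)" "a + b = b + a" "0 + a = a" "- a + a = 0" "a - b = a + - b"
    by (simp_all add: plus_quat_def zero_quat_def uminus_quat_def minus_quat_def quat_eq_iff)
  show "x *\<^sub>R (a + b) = x *\<^sub>R a + x *\<^sub>R b" "(x + y) *\<^sub>R a = x *\<^sub>R a + y *\<^sub>R a"
    "x *\<^sub>R y *\<^sub>R a = (x * y) *\<^sub>R a" "1 *\<^sub>R a = a"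
    by (simp_all add: scaleR_quat_def plus_quat_def quat_eq_iff algebra_simps)
  show "a * b * c = a * (b * c)"
    by (simp add: times_quat_def quat_eq_iff vec_eq_iff forall_3 cross3_simps)
  show "(a + b) * c = a * c + b * c" "a * (b + c) = a * b + a * c"
    by (simp_all add: times_quat_def plus_quat_def quat_eq_iff vec_eq_iff forall_3 cross3_simps)
  show "1 * a = a" "a * 1 = a" "(0::quat) \<noteq> 1"
    by (simp_all add: times_quat_def one_quat_def zero_quat_def quat_eq_iff)
  show "x *\<^sub>R a * b = x *\<^sub>R (a * b)" "a * x *\<^sub>R b = x *\<^sub>R (a * b)"
    by (simp_all add: times_quat_def scaleR_quat_def quat_eq_iff vec_eq_iff forall_3 cross3_simps)
  show "inverse (0::quat) = 0"
    by (simp add: inverse_quat_def zero_quat_def scaleR_quat_def)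
  show "a div b = a * inverse b" by (rule divide_quat_def)
  show "sgn a = inverse (norm a) *\<^sub>R a" by (rule sgn_quat_def)
  show "dist a b = norm (a - b)" by (rule dist_quat_def)
  show "(norm a = 0) = (a = 0)"
    by (simp add: norm_quat_def zero_quat_def quat_eq_iff sum_power2_eq_zero_iff)
  have "norm q = norm (scal q, vect q)" for q
    by (simp add: norm_quat_def norm_Pair)
  then show "norm (a + b) \<le> norm a + norm b"
    using norm_triangle_ineq[of "(scal a, vect a)" "(scal b, vect b)"]
    by (simp add: plus_quat_def)
  show "norm (x *\<^sub>R a) = \<bar>x\<bar> * norm a"
    by (simp add: norm_quat_def scaleR_quat_def power_mult_distrib distrib_left [symmetric]
        real_sqrt_mult)
  show "norm (a * b) = norm a * norm b"
  proof -
    have "(scal (a * b))\<^sup>2 + (norm (vect (a * b)))\<^sup>2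
        = ((scal a)\<^sup>2 + (norm (vect a))\<^sup>2) * ((scal b)\<^sup>2 + (norm (vect b))\<^sup>2)"
      unfolding power2_norm_eq_inner
      by (simp add: times_quat_def cross3_simps power2_eq_square)
    then show ?thesis
      by (simp add: norm_quat_def real_sqrt_mult [symmetric])
  qed
qed (rule uniformity_quat_def open_quat_def quat_inverse_aux | assumption)+

end

definition Imag :: "real^3 \<Rightarrow> quat" where
  "Imag v = Quat 0 v"

text \<open>If \<open>q\<close> is a negative real, then the direction \<open>v\<close> is arbitrary, hence there is no unique
  root, and the value is unspecified.\<close>

definition quat_sqrt :: "quat \<Rightarrow> quat" where
  "quat_sqrt q = (THE w. \<exists>\<phi> v. norm v = 1 \<and> 0 \<le> \<phi> \<and> \<phi> \<le> pi \<and>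
      q = norm q *\<^sub>R Quat (cos \<phi>) (sin \<phi> *\<^sub>R v) \<and>
      w = sqrt (norm q) *\<^sub>R Quat (cos (\<phi> / 2)) (sin (\<phi> / 2) *\<^sub>R v))"

definition cross_ratio :: "quat \<Rightarrow> quat \<Rightarrow> quat \<Rightarrow> quat \<Rightarrow> quat" where
  "cross_ratio a b c d = (a - b) * inverse (b - c) * (c - d) * inverse (d - a)"

section \<open>Discrete curvature circle\<close>

text \<open>Points of the extended space are of type \<^typ>\<open>quat option\<close>, with \<^term>\<open>None\<close> in the role of
  the point at infinity and \<open>Some (Imag x)\<close> in the role of the vector \<open>x\<close>. That the finite values
  below are purely imaginary is not built in. The value is only meaningful for pairwise distinct
  imaginary arguments for which \<open>cross_ratio c a b d\<close> is not a negative real.\<close>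

definition f_point :: "quat \<Rightarrow> quat \<Rightarrow> quat \<Rightarrow> quat \<Rightarrow> quat option" where
  "f_point a b c d =
     (let g = (b - a) * inverse (c - a) * quat_sqrt (cross_ratio c a b d)
      in if g + 1 = 0 then None else Some (inverse (g + 1) * (g * c + b)))"

definition f_curve :: "(int \<Rightarrow> real^3) \<Rightarrow> int \<Rightarrow> int \<Rightarrow> int \<Rightarrow> int \<Rightarrow> quat option" where
  "f_curve \<gamma> i j k l = f_point (Imag (\<gamma> i)) (Imag (\<gamma> j)) (Imag (\<gamma> k)) (Imag (\<gamma> l))"

definition p_ab :: "(int \<Rightarrow> real^3) \<Rightarrow> int \<Rightarrow> quat option" where
  "p_ab \<gamma> i = f_curve \<gamma> (i + 2) (i - 1) i (i + 1)"

definition p_bc :: "(int \<Rightarrow> real^3) \<Rightarrow> int \<Rightarrow> quat option" where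
  "p_bc \<gamma> i = f_curve \<gamma> (i - 1) i (i + 1) (i + 2)"

definition p_cd :: "(int \<Rightarrow> real^3) \<Rightarrow> int \<Rightarrow> quat option" where
  "p_cd \<gamma> i = f_curve \<gamma> i (i + 1) (i + 2) (i - 1)"

definition p_da :: "(int \<Rightarrow> real^3) \<Rightarrow> int \<Rightarrow> quat option" where
  "p_da \<gamma> i = f_curve \<gamma> (i + 1) (i + 2) (i - 1) i"

definition is_circle :: "(real^3) set \<Rightarrow> real^3 \<Rightarrow> real \<Rightarrow> bool" where
  "is_circle K m r \<longleftrightarrow> r > 0 \<and> (\<exists>n. n \<noteq> 0 \<and> K = {x. dist m x = r \<and> n \<bullet> (x - m) = 0})"

definition is_line :: "(real^3) set \<Rightarrow> bool" where
  "is_line K \<longleftrightarrow> affine K \<and> aff_dim K = 1"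

definition extended_points :: "(real^3) set \<Rightarrow> quat option set" where
  "extended_points K = (\<lambda>x. Some (Imag x)) ` K \<union> (if is_line K then {None} else {})"

definition curvature_circle :: "(int \<Rightarrow> real^3) \<Rightarrow> int \<Rightarrow> (real^3) set" where
  "curvature_circle \<gamma> i =
     (THE K. ((\<exists>m r. is_circle K m r) \<or> is_line K) \<and>
        {p_ab \<gamma> i, p_bc \<gamma> i, p_cd \<gamma> i, p_da \<gamma> i} \<subseteq> extended_points K)"

definition circle_center :: "(real^3) set \<Rightarrow> real^3" where
  "circle_center K = (THE m. \<exists>r. is_circle K m r)"

definition circle_radius :: "(real^3) set \<Rightarrow> real" where
  "circle_radius K = (THE r. \<exists>m. is_circle K m r)"

definition discrete_curvature :: "(int \<Rightarrow> real^3) \<Rightarrow> int \<Rightarrow> real" where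
  "discrete_curvature \<gamma> i =
     (let K = curvature_circle \<gamma> i in if is_line K then 0 else inverse (circle_radius K))"

definition curvature_center :: "(int \<Rightarrow> real^3) \<Rightarrow> int \<Rightarrow> real^3" where
  "curvature_center \<gamma> i = circle_center (curvature_circle \<gamma> i)"

definition sample :: "(real \<Rightarrow> real^3) \<Rightarrow> real \<Rightarrow> real \<Rightarrow> int \<Rightarrow> real^3" where
  "sample s u \<epsilon> k = s (u + (2 * real_of_int k - 1) * \<epsilon>)"

end

theory Submission
  imports Defs
begin

text \<open>The construction is best seen on the sphere (or plane) through four consecutive vertices
  \<open>a, b, c, d\<close>. The points \<open>p_bc\<close> and \<open>p_da\<close> are the fixed points of the Moebius involution that
  exchanges \<open>a\<close> with \<open>d\<close> and \<open>b\<close> with \<open>c\<close>, and \<open>p_ab\<close>, \<open>p_cd\<close> are the fixed points of the one that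
  exchanges \<open>a\<close> with \<open>b\<close> and \<open>c\<close> with \<open>d\<close>. These two involutions commute, hence the two pairs of
  points separate each other harmonically and lie on one circle.

  The circle becomes explicit after the inversion \<open>x \<mapsto> (x - p)\<^sup>-\<^sup>1\<close> at \<open>p = p_bc\<close>. As \<open>p\<close>
  goes to infinity, the first involution becomes the half-turn about the image \<open>P\<close> of \<open>p_da\<close>, and
  the vertices become a parallelogram \<open>P - q, P - e, P + e, P + q\<close> with imaginary \<open>e, q\<close>. The second
  involution then has the fixed points \<open>P \<plusminus> r\<close>, where \<open>r\<close> is the geometric mean of \<open>e\<close> and \<open>q\<close>: it
  satisfies \<open>r e\<^sup>-\<^sup>1 r = q\<close> and bisects the angle between \<open>e\<close> and \<open>q\<close>
  (\<open>commuting_fixed_points\<close>). So the curvature circle is the inverse of the line through \<open>P\<close> in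
  the direction of \<open>r\<close>. If \<open>h\<close> is the foot of the perpendicular from the origin to this line, then the
  curvature is \<open>2 \<bar>h\<bar>\<close> and the center is \<open>p - h / (2 \<bar>h\<bar>\<^sup>2)\<close>, where the sign comes from
  \<open>v\<^sup>-\<^sup>1 = - v / \<bar>v\<bar>\<^sup>2\<close> for imaginary \<open>v\<close> (\<open>discrete_curvature_parallelogram\<close>).

  For the asymptotics let \<open>V t = (s (u + t) - s u) / t\<close>. All that matters is that its inverse has
  an expansion \<open>J t = J0 + t J1 + t\<^sup>2 J2 + O(t\<^sup>3)\<close>. A point \<open>p = s u + \<epsilon> w\<close> with \<open>w \<rightarrow> 0\<close> from which
  the vertices are seen as a parallelogram is found by solving the analogous problem after
  an inversion at the vertex \<open>c\<close>, where it amounts to one geometric mean (\<open>fixed_point_exists\<close>). The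
  parallelogram condition compares \<open>J \<epsilon> - J (-\<epsilon>)\<close> with \<open>(J (3 \<epsilon>) - J (-3 \<epsilon>)) / 3\<close>, in which
  the terms linear in \<open>\<epsilon>\<close> agree and the quadratic ones drop out, while \<open>w\<close> enters as
  \<open>(16/9) J0 w J0\<close> up to a smaller error. This forces \<open>w = O(\<epsilon>\<^sup>3)\<close> (\<open>fixed_point_offset\<close>). Then \<open>P\<close> is
  an odd part of \<open>J\<close> divided by \<open>\<epsilon>\<close>, and \<open>\<epsilon> e\<close>, \<open>3 \<epsilon> q\<close> are even parts of \<open>J\<close>, so they equal \<open>J1\<close>,
  \<open>J0\<close>, \<open>J0\<close> up to \<open>O(\<epsilon>\<^sup>2)\<close> (\<open>parallelogram_expansion\<close>). Consequently \<open>h\<close> is the component of \<open>J1\<close>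
  orthogonal to the tangent, up to \<open>O(\<epsilon>\<^sup>2)\<close>, and this component is \<open>- \<kappa> N / 2\<close>
  (\<open>limit_circle\<close>). Central symmetry of the sampling in \<open>\<epsilon>\<close> is thus what produces the second order.\<close>

section \<open>Quaternion algebra\<close>

lemma scal_quat_simps [simp]:
  "scal 0 = 0" "scal 1 = 1" "scal (p + q) = scal p + scal q" "scal (p - q) = scal p - scal q"
  "scal (- p) = - scal p" "scal (c *\<^sub>R p) = c * scal p"
  "scal (p * q) = scal p * scal q - vect p \<bullet> vect q"
  by (simp_all add: zero_quat_def one_quat_def plus_quat_def minus_quat_def uminus_quat_def
      scaleR_quat_def times_quat_def)

lemma vect_quat_simps [simp]:
  "vect 0 = 0" "vect 1 = 0" "vect (p + q) = vect p + vect q" "vect (p - q) = vect p - vect q"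
  "vect (- p) = - vect p" "vect (c *\<^sub>R p) = c *\<^sub>R vect p"
  "vect (p * q) = scal p *\<^sub>R vect q + scal q *\<^sub>R vect p + cross3 (vect p) (vect q)"
  by (simp_all add: zero_quat_def one_quat_def plus_quat_def minus_quat_def uminus_quat_def
      scaleR_quat_def times_quat_def)

lemma scal_inverse [simp]: "scal (inverse q) = scal q / (norm q)\<^sup>2"
  and vect_inverse [simp]: "vect (inverse q) = - (vect q /\<^sub>R (norm q)\<^sup>2)"
  by (simp_all add: inverse_quat_def)

lemma scal_Imag [simp]: "scal (Imag v) = 0" and vect_Imag [simp]: "vect (Imag v) = v"
  by (simp_all add: Imag_def)

lemma Imag_vect: "scal q = 0 \<Longrightarrow> Imag (vect q) = q"
  by (simp add: quat_eq_iff)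

lemma norm_quat_square: "(norm q)\<^sup>2 = (scal q)\<^sup>2 + (norm (vect q))\<^sup>2"
  by (simp add: norm_quat_def)

lemma norm_imaginary: "scal q = 0 \<Longrightarrow> norm q = norm (vect q)"
  by (simp add: norm_quat_def)

lemma norm_vect_le: "norm (vect q) \<le> norm q"
  by (simp add: norm_quat_def real_le_rsqrt)

lemma bounded_linear_vect: "bounded_linear vect"
  by (rule bounded_linear_intro[where K = 1]) (simp_all add: norm_vect_le)

lemma bounded_linear_Imag: "bounded_linear Imag"
  by (rule bounded_linear_intro[where K = 1]) (simp_all add: quat_eq_iff norm_imaginary)

lemma scal_mult_commute: "scal (p * q) = scal (q * p)"
  by (simp add: inner_commute mult.commute)

text \<open>Inverting the arguments of a cross-ratio conjugates it by a quaternion. Conjugation does not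
  change the real part, which decides between the two square roots.\<close>

lemma scal_conjugate: "c \<noteq> 0 \<Longrightarrow> scal (inverse c * q * c) = scal q"
  by (metis scal_mult_commute mult.assoc mult.right_neutral right_inverse)

lemma inverse_mult_cancel [simp]:
  fixes a :: "'a::division_ring"
  assumes "a \<noteq> 0"
  shows "inverse a * (a * x) = x" "a * (inverse a * x) = x"
  using assms by (simp_all flip: mult.assoc)

lemma scal_div_imaginary:
  assumes "scal x = 0" "scal y = 0"
  shows "scal (x * inverse y) = (vect x \<bullet> vect y) / (norm y)\<^sup>2"
  using assms by (simp add: divide_inverse mult.commute)

lemma cross3_orthogonal [simp]: "x \<bullet> cross3 x y = 0" "y \<bullet> cross3 x y = 0"
  "cross3 x y \<bullet> x = 0" "cross3 x y \<bullet> y = 0"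
  by (simp_all add: dot_cross_self)

text \<open>The value is pinned down by two properties: any candidate \<open>w'\<close> squares to \<open>w * w\<close>, so it is \<open>w\<close> or
  \<open>- w\<close> once the real part is nonzero, and half angles in \<open>[0, \<pi> / 2]\<close> exclude a negative real part.\<close>

lemma quat_sqrt_square:
  assumes "scal w > 0"
  shows "quat_sqrt (w * w) = w"
  unfolding quat_sqrt_def
proof (rule the_equality)
  have nw: "norm w > 0"
    using assms by (metis norm_eq_zero scal_quat_simps(1) less_irrefl zero_less_norm_iff)
  define \<psi> where "\<psi> = arccos (scal w / norm w)"
  have le: "scal w \<le> norm w"
    unfolding norm_quat_def by (rule real_le_rsqrt) simp
  have c: "cos \<psi> = scal w / norm w"
    unfolding \<psi>_def using assms le nw by (intro cos_arccos) (auto simp: field_simps)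
  have psi: "0 \<le> \<psi>" "\<psi> \<le> pi / 2"
    unfolding \<psi>_def using assms le nw arccos_le_pi2[of "scal w / norm w"]
      arccos_lbound[of "scal w / norm w"]
    by (simp_all add: order_trans[of "- 1" 0])
  have s: "sin \<psi> = norm (vect w) / norm w"
  proof -
    have "(sin \<psi>)\<^sup>2 = (norm (vect w) / norm w)\<^sup>2"
    proof -
      have "(norm (vect w))\<^sup>2 = (norm w)\<^sup>2 - (scal w)\<^sup>2" using norm_quat_square[of w] by simp
      then show ?thesis
        unfolding sin_squared_eq c power_divide using nw by (simp add: diff_divide_distrib)
    qed
    moreover have "sin \<psi> \<ge> 0" using psi by (intro sin_ge_zero) auto
    ultimately show ?thesis using nw by (simp add: power2_eq_iff_nonneg)
  qed
  obtain v where v: "norm v = 1" "vect w = norm (vect w) *\<^sub>R v"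
  proof (cases "vect w = 0")
    case True
    then show ?thesis using that[of "axis 1 1"] by (simp add: norm_axis_1)
  next
    case False
    then show ?thesis using that[of "vect w /\<^sub>R norm (vect w)"] by simp
  qed
  have w: "w = norm w *\<^sub>R Quat (cos \<psi>) (sin \<psi> *\<^sub>R v)"
    using nw v(2) by (simp add: quat_eq_iff c s)
  have vv: "v \<bullet> v = 1" using v(1) by (simp add: norm_eq_1)
  have psi2: "0 \<le> 2 * \<psi>" "2 * \<psi> \<le> pi" using psi by simp_all
  have "w * w = norm (w * w) *\<^sub>R Quat (cos (2 * \<psi>)) (sin (2 * \<psi>) *\<^sub>R v)"
    unfolding cos_double sin_double
    by (subst (1 2) w)
      (simp add: quat_eq_iff norm_mult vv power2_eq_square algebra_simps flip: scaleR_add_left)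
  moreover have "w = sqrt (norm (w * w)) *\<^sub>R Quat (cos (2 * \<psi> / 2)) (sin (2 * \<psi> / 2) *\<^sub>R v)"
    using w by (simp add: norm_mult)
  ultimately show "\<exists>\<phi> v. norm v = 1 \<and> 0 \<le> \<phi> \<and> \<phi> \<le> pi \<and>
      w * w = norm (w * w) *\<^sub>R Quat (cos \<phi>) (sin \<phi> *\<^sub>R v) \<and>
      w = sqrt (norm (w * w)) *\<^sub>R Quat (cos (\<phi> / 2)) (sin (\<phi> / 2) *\<^sub>R v)"
    using v(1) psi2 by (intro exI[of _ "2 * \<psi>"] exI[of _ v]) simp
next
  fix w'
  assume "\<exists>\<phi> v. norm v = 1 \<and> 0 \<le> \<phi> \<and> \<phi> \<le> pi \<and>
      w * w = norm (w * w) *\<^sub>R Quat (cos \<phi>) (sin \<phi> *\<^sub>R v) \<and>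
      w' = sqrt (norm (w * w)) *\<^sub>R Quat (cos (\<phi> / 2)) (sin (\<phi> / 2) *\<^sub>R v)"
  then obtain \<phi> v where v: "norm v = 1" and phi: "0 \<le> \<phi>" "\<phi> \<le> pi"
    and q: "w * w = norm (w * w) *\<^sub>R Quat (cos \<phi>) (sin \<phi> *\<^sub>R v)"
    and w': "w' = norm w *\<^sub>R Quat (cos (\<phi> / 2)) (sin (\<phi> / 2) *\<^sub>R v)"
    by (auto simp: norm_mult)
  have vv: "v \<bullet> v = 1" using v by (simp add: norm_eq_1)
  have "w * w = w' * w'"
  proof -
    have "w * w = (norm w * norm w) *\<^sub>R Quat (cos (2 * (\<phi> / 2))) (sin (2 * (\<phi> / 2)) *\<^sub>R v)"
      using q by (simp add: norm_mult)
    also have "\<dots> = w' * w'"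
      unfolding cos_double sin_double w'
      by (simp add: quat_eq_iff vv power2_eq_square algebra_simps flip: scaleR_add_left)
    finally show ?thesis .
  qed
  then have e: "scal (w * w) = scal (w' * w')" "vect (w * w) = vect (w' * w')" by simp_all
  have "norm w = norm w'"
    using \<open>w * w = w' * w'\<close> by (metis norm_mult norm_ge_zero power2_eq_square power2_eq_iff_nonneg)
  then have "(scal w)\<^sup>2 + (norm (vect w))\<^sup>2 = (scal w')\<^sup>2 + (norm (vect w'))\<^sup>2"
    by (metis norm_quat_square)
  moreover have "(scal w)\<^sup>2 - (norm (vect w))\<^sup>2 = (scal w')\<^sup>2 - (norm (vect w'))\<^sup>2"
    using e(1) by (simp add: power2_eq_square dot_square_norm)
  ultimately have "(scal w)\<^sup>2 = (scal w')\<^sup>2" by linarith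
  moreover have "scal w' \<ge> 0"
    unfolding w' using phi by (auto intro!: mult_nonneg_nonneg cos_ge_zero)
  ultimately have sc: "scal w = scal w'"
    using assms by (simp add: power2_eq_iff_nonneg)
  have "2 * vect w = 2 * vect w'"
    using e(2) sc assms by simp
  then have "vect w = vect w'"
    by (simp add: vec_eq_iff)
  then show "w' = w" using sc by (simp add: quat_eq_iff)
qed

text \<open>In the plane spanned by \<open>x\<close> and \<open>y\<close>, identified with the complex numbers, this is a square root of
  \<open>x y\<close>: it points along the bisector of \<open>x\<close> and \<open>y\<close>, and its length is the geometric mean of their
  lengths.\<close>

definition geometric_mean :: "'a::real_normed_vector \<Rightarrow> 'a \<Rightarrow> 'a" where
  "geometric_mean x y = (let s = norm y *\<^sub>R x + norm x *\<^sub>R y in (sqrt (norm x * norm y) / norm s) *\<^sub>R s)"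

text \<open>For imaginary \<open>s\<close>, the map \<open>x \<mapsto> s x s\<close> on imaginary quaternions is the reflection in the plane
  orthogonal to \<open>s\<close>, scaled by \<open>\<bar>s\<bar>\<^sup>2\<close>.\<close>

lemma sandwich_imaginary:
  fixes s x :: quat
  assumes "scal s = 0" "scal x = 0"
  shows "s * x * s = (norm s)\<^sup>2 *\<^sub>R x - (2 * (vect s \<bullet> vect x)) *\<^sub>R s"
  using assms
  by (simp add: quat_eq_iff norm_quat_square power2_norm_eq_inner vec_eq_iff forall_3 cross3_simps)

lemma inverse_imaginary: "scal x = 0 \<Longrightarrow> inverse x = - (x /\<^sub>R (norm x)\<^sup>2)"
  by (simp add: quat_eq_iff)

text \<open>The equation \<open>r x\<^sup>-\<^sup>1 r = y\<close> replaces \<open>r\<^sup>2 = x y\<close>, which has no meaning for quaternions in a tilted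
  plane: the reflection in the line of \<open>r\<close> takes the direction of \<open>x\<close> to that of \<open>y\<close>, because \<open>r\<close> bisects the
  angle between them.\<close>

lemma geometric_mean_quat:
  fixes x y :: quat
  assumes im: "scal x = 0" "scal y = 0" and nz: "norm y *\<^sub>R x + norm x *\<^sub>R y \<noteq> 0" "x \<noteq> 0" "y \<noteq> 0"
  defines "r \<equiv> geometric_mean x y"
  shows "scal r = 0" "r \<noteq> 0" "r * inverse x * r = y" "scal (x * inverse r) > 0"
proof -
  define s where "s = norm y *\<^sub>R x + norm x *\<^sub>R y"
  define k where "k = sqrt (norm x * norm y) / norm s"
  have r: "r = k *\<^sub>R s" by (simp add: r_def geometric_mean_def Let_def k_def s_def)
  have k: "k > 0" using nz by (simp add: k_def s_def)
  define \<sigma> where "\<sigma> = norm x * norm y + vect x \<bullet> vect y"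
  have sx: "vect s \<bullet> vect x = norm x * \<sigma>"
    using im by (simp add: s_def \<sigma>_def inner_add_left inner_commute norm_imaginary dot_square_norm
        power2_eq_square algebra_simps)
  have ss: "(norm s)\<^sup>2 = 2 * norm x * norm y * \<sigma>"
  proof -
    have sq: "vect x \<bullet> vect x = norm x * norm x" "vect y \<bullet> vect y = norm y * norm y"
      using im by (simp_all add: norm_imaginary dot_square_norm power2_eq_square)
    have "(norm s)\<^sup>2 = vect s \<bullet> vect s"
      using im by (simp add: norm_quat_square s_def dot_square_norm)
    also have "\<dots> = 2 * norm x * norm y * \<sigma>"
      by (simp add: s_def inner_add_left inner_add_right sq \<sigma>_def inner_commute)
        (simp add: algebra_simps)
    finally show ?thesis .
  qed
  have "(norm s)\<^sup>2 > 0" using nz by (simp add: s_def)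
  moreover have "2 * norm x * norm y > 0" using nz by simp
  ultimately have \<sigma>: "\<sigma> > 0" unfolding ss by (rule zero_less_mult_pos)
  have k2: "k * k * (2 * \<sigma>) = 1"
  proof -
    have "k * k = norm x * norm y / (norm s)\<^sup>2" by (simp add: k_def power2_eq_square)
    also have "\<dots> = 1 / (2 * \<sigma>)" unfolding ss using nz \<sigma> by (simp add: field_simps)
    finally show ?thesis using \<sigma> by simp
  qed
  have ims: "scal s = 0" using im by (simp add: s_def)
  show "scal r = 0" "r \<noteq> 0" using ims k nz by (auto simp: r s_def)
  have "s * x * s = - (2 * (norm x)\<^sup>2 * \<sigma>) *\<^sub>R y"
    unfolding sandwich_imaginary[OF ims im(1)] ss sx
    by (simp add: s_def algebra_simps power2_eq_square)
  then have "s * inverse x * s = (2 * \<sigma>) *\<^sub>R y"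
    using nz by (simp add: inverse_imaginary[OF im(1)])
  then have "r * inverse x * r = (k * k * (2 * \<sigma>)) *\<^sub>R y" by (simp add: r)
  then show "r * inverse x * r = y" by (simp add: k2)
  show "scal (x * inverse r) > 0"
    using ims im k nz sx \<sigma>
    by (subst scal_div_imaginary) (auto simp: r inner_commute s_def intro!: divide_pos_pos mult_pos_pos)
qed

lemma tendsto_geometric_mean:
  assumes "(f \<longlongrightarrow> a) F" "(g \<longlongrightarrow> b) F" "norm b *\<^sub>R a + norm a *\<^sub>R b \<noteq> 0"
  shows "((\<lambda>t. geometric_mean (f t) (g t)) \<longlongrightarrow> geometric_mean a b) F"
  unfolding geometric_mean_def Let_def using assms by (intro tendsto_intros) auto

section \<open>The points of the curvature circle after an inversion\<close>

text \<open>Solving the formula for \<open>f\<close> for the root: \<open>f (a, b, c, d) = x\<close> holds if the root \<open>W\<close> of the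
  cross-ratio satisfies \<open>(b - a) (c - a)\<^sup>-\<^sup>1 W = - (x - b) (x - c)\<^sup>-\<^sup>1\<close>. Thus a guess for \<open>x\<close> is
  verified by one squaring and one sign.\<close>

lemma f_point_eqI:
  assumes "a \<noteq> b" "a \<noteq> c" "b \<noteq> c" "x \<noteq> c"
    and W: "W = - ((c - a) * inverse (b - a) * (x - b) * inverse (x - c))"
    and sq: "W * W = cross_ratio c a b d" and pos: "scal W > 0"
  shows "f_point a b c d = Some x"
proof -
  define g where "g = (b - a) * inverse (c - a) * W"
  have g: "g = - ((x - b) * inverse (x - c))"
    unfolding g_def W using assms(1,2) by (simp add: mult.assoc)
  have gx: "g * (x - c) = - (x - b)"
    unfolding g using assms(4) by (simp add: mult.assoc)
  have "(g + 1) * (x - c) = b - c"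
    using gx by (simp add: algebra_simps)
  then have g1: "g + 1 \<noteq> 0" using assms(3) by auto
  have "g * c + b = (g + 1) * x"
    using gx by (simp add: algebra_simps)
  then have "inverse (g + 1) * (g * c + b) = x"
    using g1 by simp
  moreover have "quat_sqrt (cross_ratio c a b d) = W"
    using quat_sqrt_square[OF pos] sq by simp
  ultimately show ?thesis
    using g1 by (simp add: f_point_def Let_def g_def)
qed

lemma inverse_difference:
  fixes a b :: "'a::division_ring"
  assumes "a \<noteq> 0" "b \<noteq> 0"
  shows "inverse a - inverse b = inverse a * (b - a) * inverse b"
  using assms by (simp add: algebra_simps)

lemma inverse_difference_swapped:
  fixes a b :: "'a::division_ring"
  assumes "a \<noteq> 0" "b \<noteq> 0"
  shows "inverse a - inverse b = inverse b * (b - a) * inverse a"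
  using assms by (simp add: algebra_simps)

text \<open>Each difference \<open>C\<^sup>-\<^sup>1 - A\<^sup>-\<^sup>1\<close> is rewritten as \<open>C\<^sup>-\<^sup>1 (A - C) A\<^sup>-\<^sup>1\<close> or as \<open>A\<^sup>-\<^sup>1 (A - C) C\<^sup>-\<^sup>1\<close>, with the
  order chosen such that neighbouring factors cancel.\<close>

lemma cross_ratio_inverted:
  fixes A B C D p :: quat
  assumes "A \<noteq> 0" "B \<noteq> 0" "C \<noteq> 0" "D \<noteq> 0" "A \<noteq> B" "C \<noteq> D"
  shows "cross_ratio (p + inverse C) (p + inverse A) (p + inverse B) (p + inverse D) =
    inverse C * ((A - C) * inverse (B - A) * (D - B) * inverse (C - D)) * C"
  using assms unfolding cross_ratio_def
  by (simp add: inverse_difference[of C A] inverse_difference_swapped[of A B]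
      inverse_difference[of B D] inverse_difference_swapped[of D C]
      nonzero_inverse_mult_distrib mult.assoc)

text \<open>The criterion \<open>f_point_eqI\<close> in the coordinate \<open>(x - p)\<^sup>-\<^sup>1\<close>. Up to conjugation only differences of
  the inverted points occur, so the common summand \<open>P\<close> of the parallelogram disappears.\<close>

lemma f_point_inverted:
  assumes nz: "A \<noteq> 0" "B \<noteq> 0" "C \<noteq> 0" "D \<noteq> 0" "X \<noteq> 0"
    and d: "A \<noteq> B" "A \<noteq> C" "B \<noteq> C" "C \<noteq> D" "X \<noteq> C"
    and W: "W = - ((A - C) * inverse (A - B) * (B - X) * inverse (C - X))"
    and sq: "W * W = (A - C) * inverse (B - A) * (D - B) * inverse (C - D)" and pos: "scal W > 0"
  shows "f_point (p + inverse A) (p + inverse B) (p + inverse C) (p + inverse D)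
    = Some (p + inverse X)"
proof (rule f_point_eqI[where W = "inverse C * W * C"])
  show "inverse C * W * C = - ((p + inverse C - (p + inverse A)) *
     inverse (p + inverse B - (p + inverse A)) * (p + inverse X - (p + inverse B)) *
     inverse (p + inverse X - (p + inverse C)))"
    using nz d
    by (simp add: W inverse_difference[of C A] inverse_difference[of B A]
        inverse_difference_swapped[of X B] inverse_difference_swapped[of X C]
        nonzero_inverse_mult_distrib mult.assoc)
  have "inverse C * W * C * (inverse C * W * C) = inverse C * (W * W) * C"
    using nz by (simp add: mult.assoc)
  then show "inverse C * W * C * (inverse C * W * C)
    = cross_ratio (p + inverse C) (p + inverse A) (p + inverse B) (p + inverse D)"
    using nz d by (simp add: cross_ratio_inverted sq)
  show "scal (inverse C * W * C) > 0"
    by (subst scal_conjugate) (use pos nz in simp_all)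
qed (use nz d in auto)

text \<open>The limit case \<open>X = \<infinity>\<close> of the previous lemma, where the point is the center of the inversion.\<close>

lemma f_point_inverted_infinity:
  assumes nz: "A \<noteq> 0" "B \<noteq> 0" "C \<noteq> 0" "D \<noteq> 0"
    and d: "A \<noteq> B" "A \<noteq> C" "B \<noteq> C" "C \<noteq> D"
    and W: "W = - ((A - C) * inverse (A - B))"
    and sq: "W * W = (A - C) * inverse (B - A) * (D - B) * inverse (C - D)" and pos: "scal W > 0"
  shows "f_point (p + inverse A) (p + inverse B) (p + inverse C) (p + inverse D) = Some p"
proof (rule f_point_eqI[where W = "inverse C * W * C"])
  show "inverse C * W * C = - ((p + inverse C - (p + inverse A)) *
     inverse (p + inverse B - (p + inverse A)) * (p - (p + inverse B)) *
     inverse (p - (p + inverse C)))"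
    using nz d
    by (simp add: W inverse_difference[of C A] inverse_difference[of B A] nonzero_inverse_mult_distrib mult.assoc)
  have "inverse C * W * C * (inverse C * W * C) = inverse C * (W * W) * C"
    using nz by (simp add: mult.assoc)
  then show "inverse C * W * C * (inverse C * W * C)
    = cross_ratio (p + inverse C) (p + inverse A) (p + inverse B) (p + inverse D)"
    using nz d by (simp add: cross_ratio_inverted sq)
  show "scal (inverse C * W * C) > 0"
    by (subst scal_conjugate) (use pos nz in simp_all)
qed (use nz d in auto)

text \<open>With \<open>z = e r\<^sup>-\<^sup>1\<close> the two half diagonals are \<open>e = z r\<close> and \<open>q = z\<^sup>-\<^sup>1 r\<close>, so all cross-ratios
  become, up to conjugation, elements of the commutative field generated by \<open>z\<close>. The roots that occur are \<open>(e + q) (e - q)\<^sup>-\<^sup>1\<close>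
  (for \<open>p_bc\<close> and \<open>p_da\<close>) and \<open>(z + z\<^sup>-\<^sup>1) / 2\<close> (for \<open>p_ab\<close> and \<open>p_cd\<close>). Their real parts are positive
  because \<open>\<bar>q\<bar> < \<bar>e\<bar>\<close> and because \<open>r\<close> encloses an acute angle with \<open>e\<close>; these two conditions select
  the right one of the two fixed points in each case.\<close>

lemma commuting_fixed_points:
  fixes p P e q r :: quat
  assumes im: "scal P = 0" "scal e = 0" "scal q = 0" "scal r = 0"
    and r: "r \<noteq> 0" "r * inverse e * r = q" "scal (e * inverse r) > 0"
    and eq: "norm q < norm e"
    and nz: "P \<noteq> 0" "P + e \<noteq> 0" "P - e \<noteq> 0" "P + q \<noteq> 0" "P - q \<noteq> 0" "P + r \<noteq> 0" "P - r \<noteq> 0"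
  defines "a \<equiv> p + inverse (P - q)" and "b \<equiv> p + inverse (P - e)"
    and "c \<equiv> p + inverse (P + e)" and "d \<equiv> p + inverse (P + q)"
  shows "f_point a b c d = Some p"
    and "f_point c d a b = Some (p + inverse P)"
    and "f_point d a b c = Some (p + inverse (P - r))"
    and "f_point b c d a = Some (p + inverse (P + r))"
proof -
  have e0: "e \<noteq> 0" using eq by auto
  then have q0: "q \<noteq> 0" using r by auto
  have ne: "e \<noteq> q" "e + q \<noteq> 0" "e - q \<noteq> 0" "q - e \<noteq> 0" "e \<noteq> - q" "q \<noteq> - e"
    using eq by (auto simp: add_eq_0_iff2)
  have er: "e \<noteq> r" "e \<noteq> - r" "r - e \<noteq> 0" "e - r \<noteq> 0" "r \<noteq> - e"
    using eq r e0 by (auto simp: mult.assoc)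
  have "norm r * norm r = norm q * norm e"
    using r(2) e0 by (auto simp: norm_mult norm_inverse)
  then have "norm q < norm r"
    using eq by (metis mult_less_cancel_left_pos not_less norm_ge_zero
        zero_less_norm_iff q0 mult_mono order_le_less_trans less_irrefl)
  then have qr: "r \<noteq> q" "r \<noteq> - q" by auto
  have two: "inverse (x + x) = inverse x /\<^sub>R 2" if "x \<noteq> 0" for x :: quat
    using nonzero_inverse_scaleR_distrib[of 2 x] that by (simp add: scaleR_2)
  have self_minus: "x \<noteq> - x" if "x \<noteq> 0" for x :: quat
  proof
    assume "x = - x"
    then have "2 *\<^sub>R x = 0" by (simp add: scaleR_2 eq_neg_iff_add_eq_0)
    then show False using that by simp
  qed
  note ne = ne self_minus[OF e0] self_minus[OF q0]
  define z where "z = e * inverse r"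
  have zi: "inverse z = r * inverse e"
    using e0 r(1) by (simp add: z_def nonzero_inverse_mult_distrib)
  have zz: "z \<noteq> 0" using e0 r(1) by (simp add: z_def)
  have e: "e = z * r" using r(1) by (simp add: z_def mult.assoc)
  have q: "q = inverse z * r" using r(2) by (simp add: zi)
  have scz: "scal z > 0" using r(3) by (simp add: z_def)
  define W where "W = (z + inverse z) /\<^sub>R 2"
  have W_pos: "scal W > 0"
    using scz zz by (simp add: W_def add_pos_nonneg)
  have ie: "inverse e = inverse r * inverse z" and iq: "inverse q = inverse r * z"
    unfolding e q using zz r(1) by (simp_all add: nonzero_inverse_mult_distrib)
  have eqr: "(e + q) * inverse r = z + inverse z"
    unfolding e q using r(1) by (simp add: distrib_right mult.assoc)
  have WW: "W * W = ((z * z + inverse z * inverse z) + (1 + 1)) /\<^sub>R 4"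
    unfolding W_def using zz
    by (simp add: algebra_simps scaleR_2 del: one_add_one flip: scaleR_add_left)
  have W1: "(e + q) * inverse q * (e + q) * inverse e = 4 *\<^sub>R (W * W)"
    "(e + q) * inverse e * (e + q) * inverse q = 4 *\<^sub>R (W * W)"
    unfolding WW ie iq e q using zz r(1) by (simp_all add: algebra_simps scaleR_2 nonzero_inverse_mult_distrib del: one_add_one)
  have diffs: "P + q - (P - e) = e + q" "P - q - (P + q) = - (q + q)" "P + e - (P - q) = e + q"
    "P - e - (P + e) = - (e + e)" "P - e - (P + q) = - (e + q)" "P + e - (P - e) = e + e"
    "P - q - (P + e) = - (e + q)" "P + q - (P - q) = q + q"
    by simp_all
  have two': "inverse (- (x + x)) = - (inverse x /\<^sub>R 2)" if "x \<noteq> 0" for x :: quat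
    using two[OF that] by (metis inverse_minus_eq)
  define U where "U = (e + q) * inverse (e - q)"
  have U_pos: "scal U > 0"
  proof -
    have "(vect (e + q)) \<bullet> (vect (e - q)) = (norm e)\<^sup>2 - (norm q)\<^sup>2"
      using im by (simp add: norm_quat_square power2_norm_eq_inner algebra_simps inner_commute)
    also have "\<dots> > 0" using eq by (simp add: power_strict_mono)
    finally show ?thesis
      unfolding U_def using im ne by (subst scal_div_imaginary) simp_all
  qed
  have flip: "inverse (q - e) = - inverse (e - q)"
    by (metis minus_diff_eq nonzero_inverse_minus_eq ne(3))
  show "f_point a b c d = Some p"
    unfolding a_def b_def c_def d_def
  proof (rule f_point_inverted_infinity[where W = U])
    show "U = - ((P - q - (P + e)) * inverse (P - q - (P - e)))"
      by (simp add: U_def algebra_simps)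
    show "U * U = (P - q - (P + e)) * inverse (P - e - (P - q)) * (P + q - (P - e)) *
      inverse (P + e - (P + q))"
      using flip by (simp add: U_def algebra_simps)
  qed (use nz ne e0 q0 U_pos in \<open>auto simp: algebra_simps add_eq_0_iff\<close>)
  show "f_point c d a b = Some (p + inverse P)"
    unfolding a_def b_def c_def d_def
  proof (rule f_point_inverted[where W = U])
    show "U = - ((P + e - (P - q)) * inverse (P + e - (P + q)) * (P + q - P) * inverse (P - q - P))"
      using q0 by (simp add: U_def mult.assoc)
    show "U * U = (P + e - (P - q)) * inverse (P + q - (P + e)) * (P - e - (P + q)) *
      inverse (P - q - (P - e))"
      using flip by (simp add: U_def algebra_simps)
  qed (use nz ne e0 q0 U_pos in \<open>auto simp: algebra_simps add_eq_0_iff\<close>)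
  show "f_point d a b c = Some (p + inverse (P - r))"
    unfolding a_def b_def c_def d_def
  proof (rule f_point_inverted[where W = W])
    have "r - q = inverse z * (e - r)"
      unfolding e q using zz by (simp add: algebra_simps)
    then have *: "(r - q) * inverse (r - e) = - inverse z"
      using er by (metis (no_types) minus_diff_eq mult.assoc mult_minus_right mult.right_neutral nonzero_inverse_minus_eq right_inverse)
    have "W = (e + q) * inverse q * inverse z /\<^sub>R 2"
      using eqr zz by (simp add: W_def iq mult.assoc)
    then show "W = - ((P + q - (P - e)) * inverse (P + q - (P - q)) * (P - q - (P - r)) *
       inverse (P - e - (P - r)))"
      using * q0 by (simp add: two mult.assoc add.commute)
    show "W * W = (P + q - (P - e)) * inverse (P - q - (P + q)) * (P + e - (P - q)) *
      inverse (P - e - (P + e))"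
      unfolding diffs two[OF e0] two[OF q0] two'[OF e0] two'[OF q0]
      using W1(1) by (simp add: mult.assoc)
  qed (use nz ne e0 q0 W_pos er qr in \<open>auto simp: algebra_simps add_eq_0_iff\<close>)
  show "f_point b c d a = Some (p + inverse (P + r))"
    unfolding a_def b_def c_def d_def
  proof (rule f_point_inverted[where W = W])
    have "q - r = inverse z * (r - e)"
      unfolding e q using zz by (simp add: algebra_simps)
    then have "inverse (q - r) = inverse (r - e) * z"
      using er zz by (simp add: nonzero_inverse_mult_distrib)
    then have "(e - r) * inverse (q - r) = - ((r - e) * inverse (r - e)) * z"
      by (metis minus_diff_eq mult.assoc mult_minus_left)
    then have *: "(e - r) * inverse (q - r) = - z"
      using er by simp
    have "W = (e + q) * inverse e * z /\<^sub>R 2"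
      using eqr zz by (simp add: W_def ie mult.assoc)
    then show "W = - ((P - e - (P + q)) * inverse (P - e - (P + e)) * (P + e - (P + r)) *
       inverse (P + q - (P + r)))"
      using * unfolding diffs two'[OF e0] by (simp add: mult.assoc del: minus_add_distrib)
    show "W * W = (P - e - (P + q)) * inverse (P + e - (P - e)) * (P - q - (P + e)) *
      inverse (P + q - (P - q))"
      unfolding diffs two[OF e0] two[OF q0] two'[OF e0] two'[OF q0]
      using W1(2) by (simp add: mult.assoc del: minus_add_distrib)
  qed (use nz ne e0 q0 W_pos er qr in \<open>auto simp: algebra_simps add_eq_0_iff\<close>)
qed

text \<open>Here the vertex \<open>c\<close> has been moved to infinity, and \<open>\<alpha>, \<beta>, \<delta>\<close> are the images of \<open>a, b, d\<close>. The involution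
  exchanging \<open>\<beta>\<close> with infinity and \<open>\<alpha>\<close> with \<open>\<delta>\<close> has the fixed points \<open>\<beta> \<plusminus> r\<close>. Inverting once more
  at \<open>X = \<beta> - r\<close> has to yield a parallelogram, whose vertex belonging to \<open>c\<close> is \<open>- X\<close>; the identity
  says that its two diagonals have the same midpoint. It reduces to
  \<open>(x + r)\<^sup>-\<^sup>1 + (y + r)\<^sup>-\<^sup>1 = r\<^sup>-\<^sup>1\<close> for \<open>y = r x\<^sup>-\<^sup>1 r\<close>.\<close>

lemma inverted_parallelogram:
  fixes \<alpha> \<beta> \<delta> r X :: "'a::division_ring"
  assumes nz: "\<alpha> \<noteq> 0" "\<beta> \<noteq> 0" "\<delta> \<noteq> 0" "r \<noteq> 0" "X \<noteq> 0" "X \<noteq> \<alpha>" "X \<noteq> \<delta>"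
    and X: "X = \<beta> - r" and xy: "\<alpha> \<noteq> \<beta>" "r * inverse (\<alpha> - \<beta>) * r = \<delta> - \<beta>"
  shows "inverse (inverse \<alpha> - inverse X) + inverse (inverse \<delta> - inverse X)
    = inverse (inverse \<beta> - inverse X) - X"
proof -
  have inv: "inverse (inverse A - inverse X) = X * inverse (X - A) * X - X" if "A \<noteq> 0" "X \<noteq> A" for A
  proof -
    have "inverse A - inverse X = inverse A * (X - A) * inverse X"
      using that nz by (simp add: inverse_difference)
    then have "inverse (inverse A - inverse X) = X * inverse (X - A) * A"
      using that nz by (simp add: nonzero_inverse_mult_distrib mult.assoc)
    also have "\<dots> = X * inverse (X - A) * X - X * inverse (X - A) * (X - A)"
      by (simp add: right_diff_distrib)
    also have "\<dots> = X * inverse (X - A) * X - X"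
      using that by (simp add: mult.assoc)
    finally show ?thesis .
  qed
  define x y where "x = \<alpha> - \<beta>" and "y = \<delta> - \<beta>"
  have x0: "x \<noteq> 0" using xy by (simp add: x_def)
  have xr: "x + r \<noteq> 0" using nz(6) by (auto simp: x_def X algebra_simps add_eq_0_iff)
  have y: "y = r * inverse x * r" using xy(2) by (simp add: x_def y_def)
  have yr: "y + r = r * inverse x * (x + r)"
    using x0 unfolding y by (simp add: algebra_simps)
  have "X \<noteq> \<beta>" using nz X by auto
  have d: "X - \<alpha> = - (x + r)" "X - \<delta> = - (y + r)" "X - \<beta> = - r"
    by (simp_all add: X x_def y_def)
  have "inverse (y + r) = inverse (x + r) * x * inverse r"
    unfolding yr using x0 xr nz by (simp add: nonzero_inverse_mult_distrib mult.assoc)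
  then have "inverse (x + r) + inverse (y + r) = inverse (x + r) * (r + x) * inverse r"
    using nz by (simp add: algebra_simps)
  also have "\<dots> = inverse r" using xr by (simp add: add.commute)
  finally have s: "inverse (X - \<alpha>) + inverse (X - \<delta>) = inverse (X - \<beta>)"
    unfolding d inverse_minus_eq by (simp only: minus_add_distrib[symmetric])
  have "inverse (inverse \<alpha> - inverse X) + inverse (inverse \<delta> - inverse X)
      = X * (inverse (X - \<alpha>) + inverse (X - \<delta>)) * X - X - X"
    using nz by (simp add: inv algebra_simps)
  also have "\<dots> = inverse (inverse \<beta> - inverse X) - X"
    unfolding s using nz \<open>X \<noteq> \<beta>\<close> by (simp add: inv)
  finally show ?thesis .
qed

section \<open>Circles in space\<close>

lemma collinear_on_sphere:
  fixes x y z m :: "real^3"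
  assumes "collinear {x, y, z}" "dist m x = r" "dist m y = r" "dist m z = r"
  shows "x = y \<or> x = z \<or> y = z"
proof (rule ccontr)
  assume ne: "\<not> (x = y \<or> x = z \<or> y = z)"
  then obtain t where t: "z - x = t *\<^sub>R (y - x)"
    using assms(1) collinear_lemma[of "y - x" "z - x"] collinear_3[of y x z]
    by (auto simp: insert_commute)
  have sq: "(x - m) \<bullet> (x - m) = r\<^sup>2" "(y - m) \<bullet> (y - m) = r\<^sup>2" "(z - m) \<bullet> (z - m) = r\<^sup>2"
    using assms(2-4) by (auto simp: dist_norm norm_minus_commute dot_square_norm)
  define v where "v = y - x"
  have y: "y - m = (x - m) + v" and z: "z - m = (x - m) + t *\<^sub>R v"
    using t by (simp_all add: v_def algebra_simps)
  have 1: "2 * ((x - m) \<bullet> v) + v \<bullet> v = 0"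
    using sq(1,2) unfolding y by (simp add: algebra_simps inner_commute)
  have 2: "t * (2 * ((x - m) \<bullet> v) + t * (v \<bullet> v)) = 0"
    using sq(1,3) unfolding z by (simp add: algebra_simps inner_commute power2_eq_square)
  have "t * (t - 1) * (v \<bullet> v) = t * (2 * ((x - m) \<bullet> v) + t * (v \<bullet> v)) - t * (2 * ((x - m) \<bullet> v) + v \<bullet> v)"
    by (simp add: algebra_simps)
  then have "t * (t - 1) * (v \<bullet> v) = 0" unfolding 1 2 by simp
  then have "t = 0 \<or> t = 1" using ne by (auto simp: v_def)
  then show False using t ne by auto
qed

lemma orthogonal_two_parallel_cross:
  fixes u v n :: "real^3"
  assumes "n \<bullet> u = 0" "n \<bullet> v = 0" "cross3 u v \<noteq> 0"
  obtains c where "n = c *\<^sub>R cross3 u v"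
proof -
  have "cross3 n (cross3 u v) = 0"
    using assms(1,2) by (simp add: Lagrange inner_commute)
  then have "collinear {0, cross3 u v, n}"
    by (simp add: cross_eq_0 insert_commute)
  then show ?thesis
    using assms(3) that by (auto simp: collinear_lemma)
qed

text \<open>Three distinct points of a circle are not collinear, hence they determine its plane; in this plane
  the center is determined by being equidistant from them.\<close>

lemma three_points_circle_unique:
  assumes K: "is_circle K m r" and K': "is_circle K' m' r'"
    and in_K: "x \<in> K" "y \<in> K" "z \<in> K" and in_K': "x \<in> K'" "y \<in> K'" "z \<in> K'"
    and ne: "x \<noteq> y" "x \<noteq> z" "y \<noteq> z"
  shows "m = m'" "r = r'" "K = K'"
proof -
  obtain n where n: "n \<noteq> 0" "K = {x. dist m x = r \<and> n \<bullet> (x - m) = 0}"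
    using K by (auto simp: is_circle_def)
  obtain n' where n': "n' \<noteq> 0" "K' = {x. dist m' x = r' \<and> n' \<bullet> (x - m') = 0}"
    using K' by (auto simp: is_circle_def)
  define w where "w = cross3 (y - x) (z - x)"
  have "\<not> collinear {x, y, z}"
    using collinear_on_sphere[of x y z m r] in_K n(2) ne by auto
  then have w0: "w \<noteq> 0"
    using collinear_3[of y x z] by (simp add: w_def cross_eq_0 NO_MATCH_def insert_commute[of x y])
  have eqd: "(c - c') \<bullet> (b - a) = 0" if "dist c a = dist c b" "dist c' a = dist c' b" for a b c c' :: "real^3"
  proof -
    have "(a - c) \<bullet> (a - c) = (b - c) \<bullet> (b - c)" "(a - c') \<bullet> (a - c') = (b - c') \<bullet> (b - c')"
      using that by (simp_all add: dist_norm norm_minus_commute dot_square_norm)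
    then show ?thesis by (simp add: algebra_simps inner_commute)
  qed
  have "n \<bullet> (y - x) = 0" "n \<bullet> (z - x) = 0"
    using in_K n(2) by (simp_all add: inner_diff_right)
  then obtain k where k: "n = k *\<^sub>R w"
    using w0 orthogonal_two_parallel_cross unfolding w_def by metis
  have "n' \<bullet> (y - x) = 0" "n' \<bullet> (z - x) = 0"
    using in_K' n'(2) by (simp_all add: inner_diff_right)
  then obtain k' where k': "n' = k' *\<^sub>R w"
    using w0 orthogonal_two_parallel_cross unfolding w_def by metis
  have k0: "k \<noteq> 0" "k' \<noteq> 0" using k k' n(1) n'(1) by auto
  have pl: "w \<bullet> (x - m) = 0" "w \<bullet> (x - m') = 0"
    using in_K(1) in_K'(1) k0 unfolding n(2) n'(2) k k' by auto
  then have "(m - m') \<bullet> w = 0" by (simp add: inner_diff_right inner_commute)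
  moreover obtain l where "m - m' = l *\<^sub>R w"
  proof (rule orthogonal_two_parallel_cross[of "m - m'" "y - x" "z - x"])
    show "(m - m') \<bullet> (y - x) = 0" "(m - m') \<bullet> (z - x) = 0"
      by (rule eqd; use in_K in_K' n(2) n'(2) in simp)+
  qed (use w0 w_def that in auto)
  ultimately show m: "m = m'" using w0 by auto
  then show r: "r = r'" using in_K(1) in_K'(1) n(2) n'(2) by auto
  show "K = K'" unfolding n(2) n'(2) k k' m r using k0 by auto
qed

lemma circle_not_on_line:
  assumes "is_circle K m r" "is_line L" "{x, y, z} \<subseteq> K" "{x, y, z} \<subseteq> L"
  shows "x = y \<or> x = z \<or> y = z"
proof -
  have "collinear L" using assms(2) by (simp add: is_line_def collinear_aff_dim)
  then have "collinear {x, y, z}" using assms(4) collinear_subset by blast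
  then show ?thesis using assms(1,3) collinear_on_sphere[of x y z m r] by (auto simp: is_circle_def)
qed

lemma Imag_inject [simp]: "Imag x = Imag y \<longleftrightarrow> x = y"
  by (simp add: Imag_def)

lemma Some_Imag_in_extended_points [simp]: "Some (Imag x) \<in> extended_points K \<longleftrightarrow> x \<in> K"
  by (auto simp: extended_points_def)

text \<open>Three distinct points of a circle exclude every line and every other circle, so one circle through
  the four points is the curvature circle.\<close>

lemma curvature_circle_eqI:
  assumes "is_circle K m r"
    and p: "p_ab \<gamma> i = Some (Imag x)" "p_bc \<gamma> i = Some (Imag y)" "p_cd \<gamma> i = Some (Imag z)"
      "p_da \<gamma> i = Some (Imag t)"
    and in_K: "x \<in> K" "y \<in> K" "z \<in> K" "t \<in> K"
    and ne: "x \<noteq> y" "x \<noteq> z" "y \<noteq> z"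
  shows "curvature_center \<gamma> i = m" and "discrete_curvature \<gamma> i = inverse r"
proof -
  have K: "curvature_circle \<gamma> i = K"
    unfolding curvature_circle_def
  proof (rule the_equality)
    fix K'
    assume K': "((\<exists>m r. is_circle K' m r) \<or> is_line K') \<and>
        {p_ab \<gamma> i, p_bc \<gamma> i, p_cd \<gamma> i, p_da \<gamma> i} \<subseteq> extended_points K'"
    then have in_K': "x \<in> K'" "y \<in> K'" "z \<in> K'" by (simp_all add: p)
    then have "\<not> is_line K'"
      using circle_not_on_line[OF assms(1), of K' x y z] in_K ne by auto
    then obtain m' r' where "is_circle K' m' r'" using K' by auto
    from three_points_circle_unique(3)[OF assms(1) this in_K(1-3) in_K' ne]
    show "K' = K" by simp
  qed (use assms in auto)
  have unique: "m' = m \<and> r' = r" if "is_circle K m' r'" for m' r'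
    using three_points_circle_unique(1,2)[OF assms(1) that in_K(1-3) in_K(1-3) ne] by simp
  show "curvature_center \<gamma> i = m"
    unfolding curvature_center_def circle_center_def K
    by (rule the_equality) (use unique assms(1) in blast)+
  have "circle_radius K = r"
    unfolding circle_radius_def by (rule the_equality) (use unique assms(1) in blast)+
  moreover have "\<not> is_line K"
    using circle_not_on_line[OF assms(1), of K x y z] in_K ne by auto
  ultimately show "discrete_curvature \<gamma> i = inverse r"
    by (simp add: discrete_curvature_def K)
qed

text \<open>The inverse of a line, with center \<open>p\<close>, is a circle through \<open>p\<close>. Its point opposite to \<open>p\<close> is the
  image \<open>p - h / \<bar>h\<bar>\<^sup>2\<close> of the point \<open>h\<close> of the line that is nearest to the origin. The image of a
  vector \<open>v\<close> is \<open>p - v / \<bar>v\<bar>\<^sup>2\<close>, as for quaternionic inversion.\<close>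

lemma inverted_line_on_circle:
  fixes p h d :: "real^3"
  assumes h: "h \<noteq> 0" and d: "d \<noteq> 0" and hd: "h \<bullet> d = 0"
  defines "m \<equiv> p - h /\<^sub>R (2 * (norm h)\<^sup>2)" and "r \<equiv> inverse (2 * norm h)"
  obtains K where "is_circle K m r" "p \<in> K"
    "\<And>\<tau>. p - (h + \<tau> *\<^sub>R d) /\<^sub>R (norm (h + \<tau> *\<^sub>R d))\<^sup>2 \<in> K"
proof
  define K where "K = {x. dist m x = r \<and> cross3 h d \<bullet> (x - m) = 0}"
  have "cross3 h d \<noteq> 0"
    using norm_and_cross_eq_0[of h d] h d hd by auto
  then show "is_circle K m r" using h by (auto simp: is_circle_def K_def r_def)
  have "norm (h /\<^sub>R (2 * (norm h)\<^sup>2)) = r"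
    using h by (simp add: r_def power2_eq_square field_simps)
  then show "p \<in> K"
    using h by (simp add: K_def m_def dist_norm)
  fix \<tau>
  define z where "z = h + \<tau> *\<^sub>R d"
  have zh: "z \<bullet> h = h \<bullet> h" "cross3 h d \<bullet> z = 0"
    using hd inner_commute[of d h] by (simp_all add: z_def inner_add_left inner_add_right)
  have z0: "z \<noteq> 0" using zh h by auto
  define a where "a = z \<bullet> z"
  define b where "b = h \<bullet> h"
  have ab: "a \<noteq> 0" "b \<noteq> 0" using z0 h by (simp_all add: a_def b_def)
  have zh': "z \<bullet> h = b" "h \<bullet> z = b" "z \<bullet> z = a" "h \<bullet> h = b"
    using zh(1) by (simp_all add: a_def b_def inner_commute)
  have "(norm (k *\<^sub>R h - l *\<^sub>R z))\<^sup>2 = k * k * b - 2 * k * l * b + l * l * a" for k l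
    unfolding power2_norm_eq_inner by (simp add: zh' inner_diff_left inner_diff_right) (simp add: algebra_simps)
  from this[of "inverse (2 * b)" "inverse a"]
  have "(norm (h /\<^sub>R (2 * b) - z /\<^sub>R a))\<^sup>2 = 1 / (4 * b)"
    using ab by (simp add: divide_simps)
  also have "\<dots> = r\<^sup>2"
    using h by (simp add: r_def b_def power2_eq_square dot_square_norm field_simps)
  finally have "norm (h /\<^sub>R (2 * b) - z /\<^sub>R a) = r"
    by (simp add: r_def power2_eq_iff_nonneg)
  then have "p - z /\<^sub>R (norm z)\<^sup>2 \<in> K"
    using zh(2) by (simp add: K_def m_def dist_norm a_def b_def dot_square_norm norm_minus_commute
        inner_diff_right)
  then show "p - (h + \<tau> *\<^sub>R d) /\<^sub>R (norm (h + \<tau> *\<^sub>R d))\<^sup>2 \<in> K" by (simp add: z_def)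
qed

text \<open>The vector \<open>d\<close> is any multiple of the bisector of \<open>e\<close> and \<open>q\<close>. This freedom is convenient for the limit, in
  which \<open>e\<close> and \<open>q\<close> diverge and have to be rescaled.\<close>

lemma discrete_curvature_parallelogram:
  fixes p P e q :: quat and d :: "real^3"
  assumes im: "scal p = 0" "scal P = 0" "scal e = 0" "scal q = 0"
    and eq: "q \<noteq> 0" "norm q < norm e"
    and nz: "P + e \<noteq> 0" "P - e \<noteq> 0" "P + q \<noteq> 0" "P - q \<noteq> 0"
    and vertices: "Imag (\<gamma> (i - 1)) = p + inverse (P - q)" "Imag (\<gamma> i) = p + inverse (P - e)"
      "Imag (\<gamma> (i + 1)) = p + inverse (P + e)" "Imag (\<gamma> (i + 2)) = p + inverse (P + q)"
    and d: "vect (norm q *\<^sub>R e + norm e *\<^sub>R q) = c *\<^sub>R d" "c \<noteq> 0" "d \<noteq> 0"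
    and h: "h = vect P - ((vect P \<bullet> d) / (d \<bullet> d)) *\<^sub>R d" "h \<noteq> 0"
  shows "p_bc \<gamma> i = Some p"
    and "curvature_center \<gamma> i = vect p - h /\<^sub>R (2 * (norm h)\<^sup>2)"
    and "discrete_curvature \<gamma> i = 2 * norm h"
proof -
  have e0: "e \<noteq> 0" using eq by auto
  have D0: "norm q *\<^sub>R e + norm e *\<^sub>R q \<noteq> 0"
    using d by (metis scaleR_eq_0_iff vect_quat_simps(1))
  define r where "r = geometric_mean e q"
  have r: "scal r = 0" "r \<noteq> 0" "r * inverse e * r = q" "scal (e * inverse r) > 0"
    unfolding r_def by (rule geometric_mean_quat[OF im(3,4) D0 e0 eq(1)])+
  obtain k where "r = k *\<^sub>R (norm q *\<^sub>R e + norm e *\<^sub>R q)"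
    by (auto simp: r_def geometric_mean_def Let_def)
  then have "vect r = (k * c) *\<^sub>R d" by (simp only: vect_quat_simps(6) d scaleR_scaleR)
  then obtain l where l: "vect r = l *\<^sub>R d" by blast
  have hd: "h \<bullet> d = 0" using d(3) by (simp add: h inner_diff_left)
  define \<mu> where "\<mu> = (vect P \<bullet> d) / (d \<bullet> d)"
  have line: "vect P = h + \<mu> *\<^sub>R d" "vect (P - r) = h + (\<mu> - l) *\<^sub>R d" "vect (P + r) = h + (\<mu> + l) *\<^sub>R d"
    by (simp_all add: h(1) \<mu>_def l algebra_simps)
  have nonzero: "h + \<tau> *\<^sub>R d \<noteq> 0" for \<tau>
  proof
    assume "h + \<tau> *\<^sub>R d = 0"
    then have "h \<bullet> (h + \<tau> *\<^sub>R d) = 0" by simp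
    then show False using hd h(2) by (simp add: inner_add_right)
  qed
  have PR: "P \<noteq> 0" "P - r \<noteq> 0" "P + r \<noteq> 0"
    using nonzero line by (metis vect_quat_simps(1))+
  note f = commuting_fixed_points[OF im(2-4) r eq(2) PR(1) nz PR(3,2), of p]
  have inv: "p + inverse Z = Imag (vect p - vect Z /\<^sub>R (norm (vect Z))\<^sup>2)" if "scal Z = 0" for Z
    using im that by (simp add: quat_eq_iff norm_imaginary)
  have four: "p_ab \<gamma> i = Some (p + inverse (P - r))" "p_bc \<gamma> i = Some p"
    "p_cd \<gamma> i = Some (p + inverse (P + r))" "p_da \<gamma> i = Some (p + inverse P)"
    unfolding p_ab_def p_bc_def p_cd_def p_da_def f_curve_def vertices by (rule f)+
  then show "p_bc \<gamma> i = Some p" by simp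
  obtain K where K: "is_circle K (vect p - h /\<^sub>R (2 * (norm h)\<^sup>2)) (inverse (2 * norm h))" "vect p \<in> K"
    "\<And>\<tau>. vect p - (h + \<tau> *\<^sub>R d) /\<^sub>R (norm (h + \<tau> *\<^sub>R d))\<^sup>2 \<in> K"
    using inverted_line_on_circle[OF h(2) d(3) hd, of "vect p"] by blast
  have four': "p_ab \<gamma> i = Some (Imag (vect (p + inverse (P - r))))" "p_bc \<gamma> i = Some (Imag (vect p))"
    "p_cd \<gamma> i = Some (Imag (vect (p + inverse (P + r))))" "p_da \<gamma> i = Some (Imag (vect (p + inverse P)))"
    using im r(1) by (simp_all add: four Imag_vect del: vect_quat_simps)
  have in_K: "vect (p + inverse (P - r)) \<in> K" "vect (p + inverse (P + r)) \<in> K" "vect (p + inverse P) \<in> K"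
    using K(3)[of "\<mu> - l"] K(3)[of "\<mu> + l"] K(3)[of \<mu>] im r(1)
    unfolding line[symmetric] by (simp_all add: inv del: vect_quat_simps)
  have "p + inverse (P - r) \<noteq> p" "p + inverse (P - r) \<noteq> p + inverse (P + r)" "p \<noteq> p + inverse (P + r)"
  proof -
    have "P - r \<noteq> P + r"
    proof
      assume "P - r = P + r"
      then have "(P + r) - (P - r) = 0" by simp
      then have "2 *\<^sub>R r = 0" by (simp add: scaleR_2)
      then show False using r(2) by simp
    qed
    then show "p + inverse (P - r) \<noteq> p" "p + inverse (P - r) \<noteq> p + inverse (P + r)" "p \<noteq> p + inverse (P + r)"
      using PR by (metis add_cancel_left_right add_left_cancel inverse_eq_iff_eq inverse_nonzero_iff_nonzero)+
  qed
  then have ne: "vect (p + inverse (P - r)) \<noteq> vect p" "vect (p + inverse (P - r)) \<noteq> vect (p + inverse (P + r))"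
    "vect p \<noteq> vect (p + inverse (P + r))"
    using im r(1) by (auto simp: quat_eq_iff)
  show "curvature_center \<gamma> i = vect p - h /\<^sub>R (2 * (norm h)\<^sup>2)"
    by (rule curvature_circle_eqI(1)[OF K(1) four' in_K(1) K(2) in_K(2,3) ne])
  show "discrete_curvature \<gamma> i = 2 * norm h"
    using curvature_circle_eqI(2)[OF K(1) four' in_K(1) K(2) in_K(2,3) ne]
    by (simp only: inverse_inverse_eq)
qed

section \<open>Expansions at zero\<close>

text \<open>The relation \<open>f t = L + O(t\<^sup>n)\<close> for \<open>t \<rightarrow> 0\<close>, for values in an arbitrary normed space.\<close>

definition near :: "nat \<Rightarrow> (real \<Rightarrow> 'a::real_normed_vector) \<Rightarrow> 'a \<Rightarrow> bool" where
  "near n f L \<longleftrightarrow> (\<exists>C. \<forall>\<^sub>F t in at 0. norm (f t - L) \<le> C * \<bar>t\<bar> ^ n)"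

lemma nearE:
  assumes "near n f L"
  obtains C where "C \<ge> 0" "\<forall>\<^sub>F t in at 0. norm (f t - L) \<le> C * \<bar>t\<bar> ^ n"
proof -
  obtain C where C: "\<forall>\<^sub>F t in at 0. norm (f t - L) \<le> C * \<bar>t\<bar> ^ n"
    using assms by (auto simp: near_def)
  have "\<forall>\<^sub>F t in at 0. norm (f t - L) \<le> \<bar>C\<bar> * \<bar>t\<bar> ^ n"
    using C by eventually_elim (meson abs_ge_self abs_ge_zero mult_right_mono order_trans zero_le_power)
  then show ?thesis using that[of "\<bar>C\<bar>"] by simp
qed

lemma nearI: "\<forall>\<^sub>F t in at 0. norm (f t - L) \<le> C * \<bar>t\<bar> ^ n \<Longrightarrow> near n f L"
  by (auto simp: near_def)

lemma near_bigo:
  assumes "near n f L"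
  shows "(\<lambda>t. norm (f t - L)) \<in> O[at 0](\<lambda>t. t ^ n)"
proof -
  obtain C where "\<forall>\<^sub>F t in at 0. norm (f t - L) \<le> C * \<bar>t\<bar> ^ n"
    using assms by (auto simp: near_def)
  then show ?thesis by (intro bigoI[where c = C]) (simp add: power_abs)
qed

lemma near_cong:
  assumes "near n f L" "\<forall>\<^sub>F t in at 0. g t = f t"
  shows "near n g L"
proof -
  obtain C where "\<forall>\<^sub>F t in at 0. norm (f t - L) \<le> C * \<bar>t\<bar> ^ n"
    using assms(1) by (auto simp: near_def)
  with assms(2) have "\<forall>\<^sub>F t in at 0. norm (g t - L) \<le> C * \<bar>t\<bar> ^ n"
    by eventually_elim simp
  then show ?thesis by (rule nearI)
qed

lemma near_const [simp, intro]: "near n (\<lambda>t. c) c"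
  by (auto simp: near_def intro!: exI[of _ 0])

lemma near_power: "near n (\<lambda>t::real. t ^ n) 0"
  by (auto simp: near_def power_abs intro!: exI[of _ 1])

lemma near_order_mono:
  assumes "near n f L" "m \<le> n"
  shows "near m f L"
proof -
  obtain C where C: "C \<ge> 0" "\<forall>\<^sub>F t in at 0. norm (f t - L) \<le> C * \<bar>t\<bar> ^ n"
    using assms(1) by (rule nearE)
  have "\<forall>\<^sub>F t in at 0. \<bar>t\<bar> < (1::real)"
    by (auto simp: eventually_at dist_real_def intro!: exI[of _ 1])
  with C(2) have "\<forall>\<^sub>F t in at 0. norm (f t - L) \<le> C * \<bar>t\<bar> ^ m"
  proof eventually_elim
    case (elim t)
    have "\<bar>t\<bar> ^ n \<le> \<bar>t\<bar> ^ m" using assms(2) elim(2) by (intro power_decreasing) auto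
    then show ?case using elim(1) C(1) mult_left_mono order_trans by blast
  qed
  then show ?thesis by (rule nearI)
qed

lemma near_zero_order:
  assumes "near 0 f L"
  shows "near 0 f M"
proof -
  obtain C where "\<forall>\<^sub>F t in at 0. norm (f t - L) \<le> C * \<bar>t\<bar> ^ 0"
    using assms by (auto simp: near_def)
  then have "\<forall>\<^sub>F t in at 0. norm (f t - M) \<le> (C + norm (L - M)) * \<bar>t\<bar> ^ 0"
  proof eventually_elim
    case (elim t)
    then show ?case using norm_triangle_ineq[of "f t - L" "L - M"] by simp
  qed
  then show ?thesis by (rule nearI)
qed

lemma tendsto_near_zero: assumes "(f \<longlongrightarrow> L) (at 0)" shows "near 0 f M"
proof -
  have "((\<lambda>t. norm (f t - M)) \<longlongrightarrow> norm (L - M)) (at 0)" using assms by (intro tendsto_intros)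
  then have "\<forall>\<^sub>F t in at 0. norm (f t - M) < norm (L - M) + 1"
    by (rule order_tendstoD) simp
  then have "\<forall>\<^sub>F t in at 0. norm (f t - M) \<le> (norm (L - M) + 1) * \<bar>t\<bar> ^ 0"
    by eventually_elim simp
  then show ?thesis by (rule nearI)
qed

lemma near_tendsto:
  assumes "near n f L" "n > 0"
  shows "(f \<longlongrightarrow> L) (at 0)"
proof -
  obtain C where C: "\<forall>\<^sub>F t in at 0. norm (f t - L) \<le> C * \<bar>t\<bar> ^ n"
    using assms(1) by (auto simp: near_def)
  have "((\<lambda>t::real. C * \<bar>t\<bar> ^ n) \<longlongrightarrow> C * \<bar>0\<bar> ^ n) (at 0)"
    by (intro tendsto_intros)
  then have "((\<lambda>t::real. C * \<bar>t\<bar> ^ n) \<longlongrightarrow> 0) (at 0)" using assms(2) by (simp add: power_0_left)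
  then have "((\<lambda>t. f t - L) \<longlongrightarrow> 0) (at 0)"
    by (rule Lim_null_comparison[OF C])
  then show ?thesis by (simp add: LIM_zero_iff)
qed

lemma near_add:
  assumes "near n f a" "near n g b"
  shows "near n (\<lambda>t. f t + g t) (a + b)"
proof -
  obtain C where C: "\<forall>\<^sub>F t in at 0. norm (f t - a) \<le> C * \<bar>t\<bar> ^ n"
    using assms(1) by (rule nearE)
  obtain D where D: "\<forall>\<^sub>F t in at 0. norm (g t - b) \<le> D * \<bar>t\<bar> ^ n"
    using assms(2) by (rule nearE)
  from C D have "\<forall>\<^sub>F t in at 0. norm (f t + g t - (a + b)) \<le> (C + D) * \<bar>t\<bar> ^ n"
  proof eventually_elim
    case (elim t)
    show ?case using norm_triangle_mono[OF elim] by (simp add: algebra_simps)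
  qed
  then show ?thesis by (rule nearI)
qed

lemma (in bounded_linear) near:
  assumes "near n g b"
  shows "near n (\<lambda>t. f (g t)) (f b)"
proof -
  obtain D where D: "\<forall>\<^sub>F t in at 0. norm (g t - b) \<le> D * \<bar>t\<bar> ^ n"
    using assms(1) by (rule nearE)
  obtain K where K: "K > 0" "\<And>x. norm (f x) \<le> norm x * K" using pos_bounded by blast
  from D have "\<forall>\<^sub>F t in at 0. norm (f (g t) - f b) \<le> (D * K) * \<bar>t\<bar> ^ n"
  proof eventually_elim
    case (elim t)
    have "norm (f (g t) - f b) \<le> norm (g t - b) * K" using K(2)[of "g t - b"] by (simp add: diff)
    also have "\<dots> \<le> D * \<bar>t\<bar> ^ n * K" using elim K(1) by (intro mult_right_mono) auto
    finally show ?case by (simp add: ac_simps)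
  qed
  then show ?thesis by (rule nearI)
qed

lemmas near_minus = bounded_linear.near[OF bounded_linear_minus[OF bounded_linear_ident]]
lemmas near_scaleR_const = bounded_linear.near[OF bounded_linear_scaleR_right]

lemma near_diff: "near n f a \<Longrightarrow> near n g b \<Longrightarrow> near n (\<lambda>t. f t - g t) (a - b)"
  using near_add[OF _ near_minus, of n f a g b] by simp

lemma near_0_iff: "near n f L \<longleftrightarrow> near n (\<lambda>t. f t - L) 0"
  by (simp add: near_def)

lemma (in bounded_bilinear) near_mult_zero:
  assumes "near m f 0" "near n g 0"
  shows "near (m + n) (\<lambda>t. prod (f t) (g t)) 0"
proof -
  obtain C where C: "\<forall>\<^sub>F t in at 0. norm (f t - 0) \<le> C * \<bar>t\<bar> ^ m" "C \<ge> 0"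
    using assms(1) by (rule nearE)
  obtain D where D: "\<forall>\<^sub>F t in at 0. norm (g t - 0) \<le> D * \<bar>t\<bar> ^ n" "D \<ge> 0"
    using assms(2) by (rule nearE)
  obtain K where K: "K > 0" "\<And>x y. norm (prod x y) \<le> norm x * norm y * K" using pos_bounded by blast
  from C(1) D(1) have "\<forall>\<^sub>F t in at 0. norm (prod (f t) (g t) - 0) \<le> (C * D * K) * \<bar>t\<bar> ^ (m + n)"
  proof eventually_elim
    case (elim t)
    have "norm (prod (f t) (g t)) \<le> norm (f t) * norm (g t) * K" by (rule K)
    also have "\<dots> \<le> (C * \<bar>t\<bar> ^ m) * (D * \<bar>t\<bar> ^ n) * K"
      using elim K(1) C(2) D(2) by (intro mult_mono) auto
    finally show ?case by (simp add: ac_simps power_add)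
  qed
  then show ?thesis by (rule nearI)
qed

lemma (in bounded_bilinear) near:
  assumes "near n f a" "near n g b"
  shows "near n (\<lambda>t. prod (f t) (g t)) (prod a b)"
proof -
  have "near 0 (\<lambda>t. g t) 0"
    using near_order_mono[OF assms(2)] near_zero_order by blast
  then have 1: "near (n + 0) (\<lambda>t. prod (f t - a) (g t)) 0"
    using assms(1) by (intro near_mult_zero) (simp flip: near_0_iff)
  have 2: "near n (\<lambda>t. prod a (g t - b)) (prod a 0)"
    using assms(2) by (intro bounded_linear.near[OF bounded_linear_right]) (simp flip: near_0_iff)
  have "near n (\<lambda>t. prod (f t) (g t) - prod a b) 0"
    using near_add[OF 1[simplified] 2] by (simp add: diff_left diff_right zero_right)
  then show ?thesis by (simp flip: near_0_iff)
qed

lemmas near_mult = bounded_bilinear.near[OF bounded_bilinear_mult]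
lemmas near_scaleR = bounded_bilinear.near[OF bounded_bilinear_scaleR]
lemmas near_inner = bounded_bilinear.near[OF bounded_bilinear_inner]

lemma near_norm:
  assumes "near n f a"
  shows "near n (\<lambda>t. norm (f t)) (norm a)"
proof -
  obtain C where C: "\<forall>\<^sub>F t in at 0. norm (f t - a) \<le> C * \<bar>t\<bar> ^ n"
    using assms(1) by (rule nearE)
  then have "\<forall>\<^sub>F t in at 0. norm (norm (f t) - norm a) \<le> C * \<bar>t\<bar> ^ n"
    by eventually_elim (simp, meson norm_triangle_ineq3 order_trans)
  then show ?thesis by (rule nearI)
qed

lemma near_inverse:
  fixes f :: "real \<Rightarrow> 'a::real_normed_div_algebra"
  assumes "near n f a" "a \<noteq> 0" "n > 0"
  shows "near n (\<lambda>t. inverse (f t)) (inverse a)"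
proof -
  have lim: "(f \<longlongrightarrow> a) (at 0)" using assms near_tendsto by blast
  then have ev: "\<forall>\<^sub>F t in at 0. f t \<noteq> 0" using assms(2) tendsto_imp_eventually_ne by blast
  have "near 0 (\<lambda>t. inverse (f t)) 0"
    using tendsto_inverse[OF lim assms(2)] by (rule tendsto_near_zero)
  moreover have "near n (\<lambda>t. (a - f t) * inverse a) 0"
    using near_mult[OF near_diff[OF near_const assms(1)] near_const, of a "inverse a"] by simp
  ultimately have "near (0 + n) (\<lambda>t. inverse (f t) * ((a - f t) * inverse a)) 0"
    by (rule bounded_bilinear.near_mult_zero[OF bounded_bilinear_mult])
  moreover have "\<forall>\<^sub>F t in at 0. inverse (f t) - inverse a = inverse (f t) * ((a - f t) * inverse a)"
    using ev by eventually_elim (simp add: assms(2) left_diff_distrib right_diff_distrib flip: mult.assoc)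
  ultimately have "near n (\<lambda>t. inverse (f t) - inverse a) 0"
    using near_cong[of n "\<lambda>t. inverse (f t) * ((a - f t) * inverse a)"] by simp
  then show ?thesis by (simp flip: near_0_iff)
qed

lemma eventually_at_zero_scale:
  assumes "eventually P (at (0::real))" "c \<noteq> 0"
  shows "\<forall>\<^sub>F t in at 0. P (c * t)"
proof -
  have "filterlim (\<lambda>t. c * t) (at 0) (at 0)"
    using assms(2) by (auto intro!: filterlim_atI tendsto_eq_intros eventually_neq_at_within eventually_at_ball
        simp: eventually_at_filter)
  then show ?thesis using assms(1) by (simp add: filterlim_iff)
qed

lemma near_scale_argument:
  assumes "near n f a" "c \<noteq> 0"
  shows "near n (\<lambda>t. f (c * t)) a"
proof -
  obtain C where C: "\<forall>\<^sub>F t in at 0. norm (f t - a) \<le> C * \<bar>t\<bar> ^ n"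
    using assms(1) by (rule nearE)
  have "\<forall>\<^sub>F t in at 0. norm (f (c * t) - a) \<le> (C * \<bar>c\<bar> ^ n) * \<bar>t\<bar> ^ n"
    using eventually_at_zero_scale[OF C assms(2)]
    by eventually_elim (simp add: abs_mult power_mult_distrib ac_simps)
  then show ?thesis by (rule nearI)
qed

lemma near_divide_argument:
  assumes "near (Suc n) f 0"
  shows "near n (\<lambda>t. f t /\<^sub>R t) 0"
proof -
  obtain C where C: "\<forall>\<^sub>F t in at 0. norm (f t - 0) \<le> C * \<bar>t\<bar> ^ Suc n"
    using assms(1) by (rule nearE)
  moreover have "\<forall>\<^sub>F t in at (0::real). t \<noteq> 0" by (simp add: eventually_at_filter)
  ultimately have "\<forall>\<^sub>F t in at 0. norm (f t /\<^sub>R t - 0) \<le> C * \<bar>t\<bar> ^ n"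
    by eventually_elim (simp add: field_simps)
  then show ?thesis by (rule nearI)
qed

text \<open>The coefficients of the inverse are found by comparing coefficients in \<open>V t * J t = 1\<close>; a
  polynomial \<open>j\<close> with \<open>V t * j t = 1 + O(t\<^sup>3)\<close> differs from the inverse by \<open>O(t\<^sup>3)\<close> only, as the inverse is
  bounded.\<close>

lemma near_inverse_expansion:
  fixes V :: "real \<Rightarrow> 'a::real_normed_div_algebra"
  assumes V: "near 3 (\<lambda>t. V t - (V1 + t *\<^sub>R V2 + t\<^sup>2 *\<^sub>R V3)) 0" and V1: "V1 \<noteq> 0"
  defines "J0 \<equiv> inverse V1"
  defines "J1 \<equiv> - (J0 * V2 * J0)"
  obtains J2 where "near 3 (\<lambda>t. inverse (V t) - (J0 + t *\<^sub>R J1 + t\<^sup>2 *\<^sub>R J2)) 0"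
proof
  define J2 where "J2 = - (J0 * (V2 * J1 + V3 * J0))"
  define v j where "v t = V1 + t *\<^sub>R V2 + t\<^sup>2 *\<^sub>R V3" and "j t = J0 + t *\<^sub>R J1 + t\<^sup>2 *\<^sub>R J2" for t
  have v_lim: "(v \<longlongrightarrow> V1) (at 0)" and j_lim: "(j \<longlongrightarrow> J0) (at 0)"
    unfolding v_def j_def by (auto intro!: tendsto_eq_intros)
  have "(V \<longlongrightarrow> V1) (at 0)"
    using tendsto_add[OF near_tendsto[OF V] v_lim] by (simp add: v_def)
  then have inv_lim: "((\<lambda>t. inverse (V t)) \<longlongrightarrow> J0) (at 0)" and ev: "\<forall>\<^sub>F t in at 0. V t \<noteq> 0"
    using V1 unfolding J0_def by (auto intro!: tendsto_inverse intro: tendsto_imp_eventually_ne)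
  have c: "V1 * J0 = 1" "V2 * J0 + V1 * J1 = 0" "V3 * J0 + V2 * J1 + V1 * J2 = 0"
    using V1 by (simp_all add: J0_def J1_def J2_def mult.assoc)
  define k where "k t = (V3 * J1 + V2 * J2) + t *\<^sub>R (V3 * J2)" for t
  have vj: "v t * j t - 1 = t ^ 3 *\<^sub>R k t" for t
  proof -
    have "v t * j t = V1 * J0 + t *\<^sub>R (V2 * J0 + V1 * J1) + t\<^sup>2 *\<^sub>R (V3 * J0 + V2 * J1 + V1 * J2) + t ^ 3 *\<^sub>R k t"
      by (simp add: v_def j_def k_def algebra_simps power2_eq_square power3_eq_cube)
    then show ?thesis by (simp add: c)
  qed
  have "near (3 + 0) (\<lambda>t. t ^ 3 *\<^sub>R k t) 0"
    by (intro bounded_bilinear.near_mult_zero[OF bounded_bilinear_scaleR] near_power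
        tendsto_near_zero[where L = "V3 * J1 + V2 * J2"])
      (auto simp: k_def intro!: tendsto_eq_intros)
  moreover have "near (3 + 0) (\<lambda>t. (V t - v t) * j t) 0"
    using V j_lim unfolding v_def
    by (intro bounded_bilinear.near_mult_zero[OF bounded_bilinear_mult] tendsto_near_zero)
  ultimately have "near 3 (\<lambda>t. t ^ 3 *\<^sub>R k t + (V t - v t) * j t) (0 + 0)"
    by (intro near_add) auto
  then have "near 3 (\<lambda>t. V t * j t - 1) 0"
    by (simp add: left_diff_distrib flip: vj)
  then have "near (0 + 3) (\<lambda>t. - inverse (V t) * (V t * j t - 1)) 0"
    using inv_lim by (intro bounded_bilinear.near_mult_zero[OF bounded_bilinear_mult]
        tendsto_near_zero[where L = "- J0"] tendsto_minus)
  moreover have "\<forall>\<^sub>F t in at 0. inverse (V t) - j t = - inverse (V t) * (V t * j t - 1)"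
    using ev by eventually_elim (simp add: right_diff_distrib flip: mult.assoc)
  ultimately show "near 3 (\<lambda>t. inverse (V t) - (J0 + t *\<^sub>R J1 + t\<^sup>2 *\<^sub>R J2)) 0"
    unfolding j_def using near_cong[of 3 "\<lambda>t. - inverse (V t) * (V t * j t - 1)"] by (simp add: j_def)
qed

lemma near_odd_part:
  fixes J :: "real \<Rightarrow> 'a::real_normed_vector"
  assumes "near 3 (\<lambda>t. J t - (J0 + t *\<^sub>R J1 + t\<^sup>2 *\<^sub>R J2)) 0"
  shows "near 3 (\<lambda>t. J t - J (- t) - (2 * t) *\<^sub>R J1) 0"
proof (rule near_cong)
  show "near 3 (\<lambda>t. (J t - (J0 + t *\<^sub>R J1 + t\<^sup>2 *\<^sub>R J2)) - (J (- t) - (J0 - t *\<^sub>R J1 + t\<^sup>2 *\<^sub>R J2))) 0"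
    using near_diff[OF assms near_scale_argument[OF assms, of "- 1"]] by simp
qed (intro always_eventually allI; simp only: mult_2 scaleR_add_left; simp)

lemma near_even_part:
  fixes J :: "real \<Rightarrow> 'a::real_normed_vector"
  assumes "near 3 (\<lambda>t. J t - (J0 + t *\<^sub>R J1 + t\<^sup>2 *\<^sub>R J2)) 0"
  shows "near 2 (\<lambda>t. (J t + J (- t)) /\<^sub>R 2) J0"
proof -
  have "near 3 (\<lambda>t. (J t - (J0 + t *\<^sub>R J1 + t\<^sup>2 *\<^sub>R J2)) + (J (- t) - (J0 - t *\<^sub>R J1 + t\<^sup>2 *\<^sub>R J2))) 0"
    using near_add[OF assms near_scale_argument[OF assms, of "- 1"]] by simp
  then have "near 2 (\<lambda>t. (J t - (J0 + t *\<^sub>R J1 + t\<^sup>2 *\<^sub>R J2)) + (J (- t) - (J0 - t *\<^sub>R J1 + t\<^sup>2 *\<^sub>R J2))) 0"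
    by (rule near_order_mono) simp
  moreover have "near 2 (\<lambda>t. t\<^sup>2 *\<^sub>R J2) 0"
    using near_scaleR[OF near_power[of 2] near_const, of J2] by simp
  ultimately have *: "near 2 (\<lambda>t. ((J t - (J0 + t *\<^sub>R J1 + t\<^sup>2 *\<^sub>R J2)) + (J (- t) - (J0 - t *\<^sub>R J1 + t\<^sup>2 *\<^sub>R J2)))
      + (t\<^sup>2 *\<^sub>R J2 + t\<^sup>2 *\<^sub>R J2)) (0 + (0 + 0))"
    by (intro near_add[where a = 0])
  have "near 2 (\<lambda>t. J t + J (- t) - 2 *\<^sub>R J0) 0"
    by (rule near_cong[OF *[simplified add_0]]) (intro always_eventually allI; simp add: scaleR_2)
  then have "near 2 (\<lambda>t. (1/2) *\<^sub>R (J t + J (- t) - 2 *\<^sub>R J0)) ((1/2) *\<^sub>R 0)"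
    by (rule near_scaleR_const)
  then show ?thesis by (subst near_0_iff) (simp add: scaleR_diff_right)
qed

text \<open>The remainder formula is applied to the coordinates; the fourth derivative is bounded near \<open>u\<close>
  by continuity.\<close>

lemma curve_taylor:
  assumes "C_k_curve 4 s"
  shows "near 4 (\<lambda>t. s (u + t) - (s u + t *\<^sub>R iter_deriv 1 s u + (t ^ 2 / 2) *\<^sub>R iter_deriv 2 s u
      + (t ^ 3 / 6) *\<^sub>R iter_deriv 3 s u)) 0"
proof -
  define g where "g j t = iter_deriv j s (u + t)" for j t
  have der: "((\<lambda>t. g j t $ i) has_real_derivative (g (Suc j) t $ i)) (at t)" if "j < 4" for i j t
  proof -
    have "iter_deriv j s differentiable at (u + t)"
      using assms that by (auto simp: C_k_curve_def)
    then have "(iter_deriv j s has_vector_derivative iter_deriv (Suc j) s (u + t)) (at (u + t))"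
      by (simp add: iter_deriv_def vector_derivative_works)
    then have "((\<lambda>t. iter_deriv j s (u + t)) has_vector_derivative iter_deriv (Suc j) s (u + t)) (at t)"
      using vector_diff_chain_at[of "\<lambda>t. u + t" 1 t "iter_deriv j s"]
        has_vector_derivative_add[OF has_vector_derivative_const has_vector_derivative_id, of u "at t"]
      by (simp add: o_def)
    from bounded_linear.has_vector_derivative[OF bounded_linear_vec_nth[of i] this] show ?thesis
      by (simp add: g_def has_real_derivative_iff_has_vector_derivative)
  qed
  have cont: "continuous_on {-1..1} (\<lambda>t. g 4 t)"
    unfolding g_def using assms
    by (auto simp: C_k_curve_def intro!: continuous_intros continuous_on_compose2[of UNIV "iter_deriv 4 s"])
  have "compact (g 4 ` {-1..1})" using cont by (intro compact_continuous_image) auto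
  then obtain M where M: "\<And>t. \<bar>t\<bar> \<le> 1 \<Longrightarrow> norm (g 4 t) \<le> M"
    using compact_imp_bounded[of "g 4 ` {-1..1}"] unfolding bounded_iff
    by (force simp: abs_le_iff)
  define R where "R t = s (u + t) - (s u + t *\<^sub>R iter_deriv 1 s u + (t ^ 2 / 2) *\<^sub>R iter_deriv 2 s u
      + (t ^ 3 / 6) *\<^sub>R iter_deriv 3 s u)" for t
  have comp: "\<bar>R t $ i\<bar> \<le> M * \<bar>t\<bar> ^ 4" if "\<bar>t\<bar> \<le> 1" for t i
  proof -
    have "\<exists>x. \<bar>x\<bar> \<le> \<bar>t\<bar> \<and> g 0 t $ i = (\<Sum>m<4. g m 0 $ i / fact m * t ^ m) + g 4 x $ i / fact 4 * t ^ 4"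
      by (rule Maclaurin_bi_le[where diff = "\<lambda>j t. g j t $ i"]) (use der in auto)
    then obtain x where x: "\<bar>x\<bar> \<le> \<bar>t\<bar>"
      "g 0 t $ i = (\<Sum>m<4. g m 0 $ i / fact m * t ^ m) + g 4 x $ i / fact 4 * t ^ 4" by blast
    have R: "R t $ i = g 4 x $ i / 24 * t ^ 4"
      using x(2) by (simp add: R_def g_def iter_deriv_def eval_nat_numeral algebra_simps)
    have "\<bar>g 4 x $ i\<bar> \<le> M"
      using M[of x] x(1) that component_le_norm_cart[of "g 4 x" i] by linarith
    then have "\<bar>g 4 x $ i\<bar> / 24 \<le> M" by linarith
    then show ?thesis
      unfolding R abs_mult power_abs abs_divide by (intro mult_right_mono) auto
  qed
  have "norm (R t) \<le> (3 * M) * \<bar>t\<bar> ^ 4" if "\<bar>t\<bar> \<le> 1" for t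
  proof -
    have "norm (R t) \<le> (\<Sum>i\<in>UNIV. \<bar>R t $ i\<bar>)" by (rule norm_le_l1_cart)
    also have "\<dots> \<le> (\<Sum>i\<in>(UNIV::3 set). M * \<bar>t\<bar> ^ 4)" by (intro sum_mono comp that)
    finally show ?thesis by simp
  qed
  then have "\<forall>\<^sub>F t in at 0. norm (R t - 0) \<le> (3 * M) * \<bar>t\<bar> ^ 4"
    by (auto simp: eventually_at dist_real_def intro!: exI[of _ 1])
  then show ?thesis unfolding R_def by (rule nearI)
qed

section \<open>Asymptotics of the inverted vertices\<close>

text \<open>Abstracts the difference quotient \<open>V t = (s (u + t) - s u) / t\<close> of a curve, as an imaginary
  quaternion, with its expansion at zero.\<close>

locale chord_quotient =
  fixes V :: "real \<Rightarrow> quat" and V1 V2 V3 :: quat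
  assumes imaginary: "scal (V t) = 0" "scal V1 = 0" "scal V2 = 0"
    and V1_nonzero: "V1 \<noteq> 0"
    and expansion: "near 3 (\<lambda>t. V t - (V1 + t *\<^sub>R V2 + t\<^sup>2 *\<^sub>R V3)) 0"
begin

text \<open>The first two coefficients in the expansion of the inverse of \<open>V\<close> at zero.\<close>

definition "J0 = inverse V1"

definition "J1 = - (J0 * V2 * J0)"

lemma J0: "J0 \<noteq> 0" "scal J0 = 0" "inverse J0 = V1"
  using V1_nonzero imaginary by (simp_all add: J0_def)

lemma V_tendsto: "c \<noteq> 0 \<Longrightarrow> ((\<lambda>t. V (c * t)) \<longlongrightarrow> V1) (at 0)"
proof -
  assume "c \<noteq> 0"
  have "((\<lambda>t. V1 + t *\<^sub>R V2 + t\<^sup>2 *\<^sub>R V3) \<longlongrightarrow> V1) (at 0)"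
    by (auto intro!: tendsto_eq_intros)
  from tendsto_add[OF near_tendsto[OF expansion] this] have "(V \<longlongrightarrow> V1) (at 0)" by simp
  moreover have "filterlim (\<lambda>t. c * t) (at 0) (at 0)"
    unfolding filterlim_iff using eventually_at_zero_scale[OF _ \<open>c \<noteq> 0\<close>] by blast
  ultimately show ?thesis by (rule filterlim_compose)
qed

lemmas V_limits = V_tendsto[of 1, simplified] V_tendsto[of "- 1", simplified]
  V_tendsto[of 3, simplified] V_tendsto[of "- 3", simplified]

text \<open>The point \<open>p = s u + t w\<close> is constructed in the coordinate that has the vertex \<open>c = s (u + t)\<close> at
  infinity, scaled by \<open>t\<close>. The scaled images \<open>\<alpha>, \<beta>, \<delta>\<close> of the other vertices tend to \<open>- J0 / 4\<close>,
  \<open>- J0 / 2\<close>, \<open>J0 / 2\<close>, so the geometric mean \<open>r\<close> tends to \<open>J0 / 2\<close>, and \<open>\<beta> - r\<close> tends to \<open>- J0\<close>, which is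
  the image of \<open>s u\<close>. The equation is the parallelogram condition, multiplied by \<open>t\<close>.\<close>

lemma fixed_point_exists:
  obtains w where "(w \<longlongrightarrow> 0) (at 0)"
    "\<forall>\<^sub>F t in at 0. scal (w t) = 0 \<and>
      (inverse (V (3 * t) - w t /\<^sub>R 3) - inverse (V (- 3 * t) + w t /\<^sub>R 3)) /\<^sub>R 3
        = inverse (V t - w t) - inverse (V (- t) + w t)"
proof
  define \<alpha> where "\<alpha> t = inverse (- (3 *\<^sub>R V (- 3 * t)) - V t)" for t
  define \<beta> where "\<beta> t = inverse (- V (- t) - V t)" for t
  define \<delta> where "\<delta> t = inverse (3 *\<^sub>R V (3 * t) - V t)" for t
  define r where "r t = geometric_mean (\<alpha> t - \<beta> t) (\<delta> t - \<beta> t)" for t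
  define X where "X t = \<beta> t - r t" for t
  define w where "w t = V t + inverse (X t)" for t
  have inv: "((\<lambda>t. inverse (f t)) \<longlongrightarrow> inverse c *\<^sub>R J0) (at 0)"
    if "(f \<longlongrightarrow> c *\<^sub>R V1) (at 0)" "c \<noteq> 0" for f c
    using tendsto_inverse[OF that(1)] that(2) V1_nonzero by (simp add: J0_def inverse_scaleR_distrib)
  note V3 = tendsto_scaleR[OF tendsto_const[of 3] V_limits(3)]
    tendsto_minus[OF tendsto_scaleR[OF tendsto_const[of 3] V_limits(4)]]
  have "((\<lambda>t. - (3 *\<^sub>R V (- 3 * t)) - V t) \<longlongrightarrow> (- 4) *\<^sub>R V1) (at 0)"
    using tendsto_diff[OF V3(2) V_limits(1)] scaleR_left_diff_distrib[of "- 3" 1 V1] by simp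
  from inv[OF this] have \<alpha>: "(\<alpha> \<longlongrightarrow> (- 1 / 4) *\<^sub>R J0) (at 0)"
    unfolding \<alpha>_def by simp
  have "((\<lambda>t. - V (- t) - V t) \<longlongrightarrow> (- 2) *\<^sub>R V1) (at 0)"
    using tendsto_diff[OF tendsto_minus[OF V_limits(2)] V_limits(1)] by (simp add: scaleR_2)
  from inv[OF this] have \<beta>: "(\<beta> \<longlongrightarrow> (- 1 / 2) *\<^sub>R J0) (at 0)"
    unfolding \<beta>_def by simp
  have "((\<lambda>t. 3 *\<^sub>R V (3 * t) - V t) \<longlongrightarrow> 2 *\<^sub>R V1) (at 0)"
    using tendsto_diff[OF V3(1) V_limits(1)] scaleR_left_diff_distrib[of 3 1 V1] by simp
  from inv[OF this] have \<delta>: "(\<delta> \<longlongrightarrow> (1 / 2) *\<^sub>R J0) (at 0)"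
    unfolding \<delta>_def by simp
  have x: "((\<lambda>t. \<alpha> t - \<beta> t) \<longlongrightarrow> (1 / 4) *\<^sub>R J0) (at 0)"
    using tendsto_diff[OF \<alpha> \<beta>] by (simp flip: scaleR_left_diff_distrib scaleR_minus_left)
  have y: "((\<lambda>t. \<delta> t - \<beta> t) \<longlongrightarrow> J0) (at 0)"
    using tendsto_diff[OF \<delta> \<beta>] by (simp flip: scaleR_left_diff_distrib scaleR_minus_left)
  have s: "norm J0 *\<^sub>R ((1 / 4) *\<^sub>R J0) + norm ((1 / 4) *\<^sub>R J0) *\<^sub>R J0 = (norm J0 / 2) *\<^sub>R J0"
    by (simp flip: scaleR_left_distrib)
  have "(r \<longlongrightarrow> geometric_mean ((1 / 4) *\<^sub>R J0) J0) (at 0)"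
    unfolding r_def
  proof (intro tendsto_geometric_mean x y)
    show "norm J0 *\<^sub>R ((1 / 4) *\<^sub>R J0) + norm ((1 / 4) *\<^sub>R J0) *\<^sub>R J0 \<noteq> 0"
      unfolding s using J0 by simp
  qed
  also have "geometric_mean ((1 / 4) *\<^sub>R J0) J0 = (1 / 2) *\<^sub>R J0"
    unfolding geometric_mean_def Let_def s using J0 by (simp add: real_sqrt_mult real_sqrt_divide)
  finally have r: "(r \<longlongrightarrow> (1 / 2) *\<^sub>R J0) (at 0)" .
  have X: "(X \<longlongrightarrow> - J0) (at 0)"
    unfolding X_def using tendsto_diff[OF \<beta> r]
    by (simp flip: scaleR_left_diff_distrib scaleR_minus_left)
  have "(w \<longlongrightarrow> V1 + inverse (- J0)) (at 0)"
    unfolding w_def using J0 by (intro tendsto_intros V_limits X) auto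
  then show "(w \<longlongrightarrow> 0) (at 0)" by (simp add: J0)
  have X\<alpha>: "((\<lambda>t. X t - \<alpha> t) \<longlongrightarrow> (- 3 / 4) *\<^sub>R J0) (at 0)"
    using tendsto_diff[OF X \<alpha>] scaleR_left_diff_distrib[of "- 1" "- 1 / 4" J0] by simp
  have X\<delta>: "((\<lambda>t. X t - \<delta> t) \<longlongrightarrow> (- 3 / 2) *\<^sub>R J0) (at 0)"
    using tendsto_diff[OF X \<delta>] scaleR_left_diff_distrib[of "- 1" "1 / 2" J0] by simp
  have sum: "((\<lambda>t. norm (\<delta> t - \<beta> t) *\<^sub>R (\<alpha> t - \<beta> t) + norm (\<alpha> t - \<beta> t) *\<^sub>R (\<delta> t - \<beta> t))
      \<longlongrightarrow> (norm J0 / 2) *\<^sub>R J0) (at 0)"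
    unfolding s[symmetric] by (intro tendsto_intros x y)
  have nz: "\<forall>\<^sub>F t in at 0. f t \<noteq> 0" if "(f \<longlongrightarrow> c *\<^sub>R J0) (at 0)" "c \<noteq> 0" for f :: "real \<Rightarrow> quat" and c
    using tendsto_imp_eventually_ne[OF that(1), of 0] that(2) J0 by simp
  have im: "scal (\<alpha> t) = 0" "scal (\<beta> t) = 0" "scal (\<delta> t) = 0" for t
    by (simp_all add: \<alpha>_def \<beta>_def \<delta>_def imaginary)
  have "\<forall>\<^sub>F t in at 0. \<alpha> t \<noteq> 0" "\<forall>\<^sub>F t in at 0. \<beta> t \<noteq> 0" "\<forall>\<^sub>F t in at 0. \<delta> t \<noteq> 0"
    "\<forall>\<^sub>F t in at 0. \<alpha> t - \<beta> t \<noteq> 0" "\<forall>\<^sub>F t in at 0. \<delta> t - \<beta> t \<noteq> 0"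
    "\<forall>\<^sub>F t in at 0. X t \<noteq> 0" "\<forall>\<^sub>F t in at 0. X t - \<alpha> t \<noteq> 0" "\<forall>\<^sub>F t in at 0. X t - \<delta> t \<noteq> 0"
    "\<forall>\<^sub>F t in at 0. norm (\<delta> t - \<beta> t) *\<^sub>R (\<alpha> t - \<beta> t) + norm (\<alpha> t - \<beta> t) *\<^sub>R (\<delta> t - \<beta> t) \<noteq> 0"
    using nz[OF \<alpha>] nz[OF \<beta>] nz[OF \<delta>] nz[OF x] nz[of "\<lambda>t. \<delta> t - \<beta> t" 1] y nz[of X "- 1"] X nz[OF X\<alpha>] nz[OF X\<delta>]
      nz[OF sum] J0 by simp_all
  then show "\<forall>\<^sub>F t in at 0. scal (w t) = 0 \<and>
      (inverse (V (3 * t) - w t /\<^sub>R 3) - inverse (V (- 3 * t) + w t /\<^sub>R 3)) /\<^sub>R 3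
        = inverse (V t - w t) - inverse (V (- t) + w t)"
  proof eventually_elim
    case (elim t)
    have gm: "scal (r t) = 0" "r t \<noteq> 0" "r t * inverse (\<alpha> t - \<beta> t) * r t = \<delta> t - \<beta> t"
      unfolding r_def by (rule geometric_mean_quat; use elim im in simp)+
    have "inverse (inverse (\<alpha> t) - inverse (X t)) + inverse (inverse (\<delta> t) - inverse (X t))
      = inverse (inverse (\<beta> t) - inverse (X t)) - X t"
      by (rule inverted_parallelogram[where r = "r t"]) (use elim gm in \<open>simp_all add: X_def\<close>)
    moreover have "inverse (\<alpha> t) - inverse (X t) = (- 3) *\<^sub>R (V (- 3 * t) + w t /\<^sub>R 3)"
      "inverse (\<delta> t) - inverse (X t) = 3 *\<^sub>R (V (3 * t) - w t /\<^sub>R 3)"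
      "inverse (\<beta> t) - inverse (X t) = - (V (- t) + w t)"
      by (simp_all add: \<alpha>_def \<beta>_def \<delta>_def w_def algebra_simps)
    moreover have "inverse (V t - w t) = - X t"
      by (simp add: w_def)
    ultimately have "inverse ((- 3) *\<^sub>R (V (- 3 * t) + w t /\<^sub>R 3)) + inverse (3 *\<^sub>R (V (3 * t) - w t /\<^sub>R 3))
        = inverse (- (V (- t) + w t)) + inverse (V t - w t)"
      by (simp only: diff_conv_add_uminus)
    then have "(inverse (V (3 * t) - w t /\<^sub>R 3) - inverse (V (- 3 * t) + w t /\<^sub>R 3)) /\<^sub>R 3
        = inverse (V t - w t) - inverse (V (- t) + w t)"
      unfolding inverse_scaleR_distrib inverse_minus_eq by (simp add: scaleR_diff_right)
    moreover have "scal (w t) = 0"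
      using im gm by (simp add: w_def X_def imaginary)
    ultimately show ?case by simp
  qed
qed

text \<open>Solving the parallelogram condition for \<open>w\<close>. Each of the four inverses is \<open>J\<close> at the same argument,
  corrected by a term \<open>K w L\<close> with \<open>K, L \<rightarrow> J0\<close>; the coefficients of the corrections, moved to one side,
  are \<open>1/9, 1/9, -1, -1\<close>, and \<open>w \<mapsto> J0 w J0\<close> scales norms by the constant \<open>\<bar>J0\<bar>\<^sup>2\<close>. On the other side
  remains a combination of odd parts of \<open>J\<close> in which the linear terms cancel.\<close>

lemma fixed_point_offset:
  assumes w: "(w \<longlongrightarrow> 0) (at 0)"
    and eq: "\<forall>\<^sub>F t in at 0.
      (inverse (V (3 * t) - w t /\<^sub>R 3) - inverse (V (- 3 * t) + w t /\<^sub>R 3)) /\<^sub>R 3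
        = inverse (V t - w t) - inverse (V (- t) + w t)"
  shows "near 3 w 0"
proof -
  define J where "J t = inverse (V t)" for t
  obtain J2 where J2: "near 3 (\<lambda>t. J t - (J0 + t *\<^sub>R J1 + t\<^sup>2 *\<^sub>R J2)) 0"
    using near_inverse_expansion[OF expansion V1_nonzero]
    unfolding J_def J0_def J1_def by metis
  define K1 where "K1 t = inverse (V (3 * t) - w t /\<^sub>R 3)" for t
  define K2 where "K2 t = inverse (V (- 3 * t) + w t /\<^sub>R 3)" for t
  define K3 where "K3 t = inverse (V t - w t)" for t
  define K4 where "K4 t = inverse (V (- t) + w t)" for t
  have w3: "((\<lambda>t. w t /\<^sub>R 3) \<longlongrightarrow> 0) (at 0)" using tendsto_scaleR[OF tendsto_const w, of "inverse 3"] by simp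
  have dl: "((\<lambda>t. V (3 * t) - w t /\<^sub>R 3) \<longlongrightarrow> V1) (at 0)" "((\<lambda>t. V (- 3 * t) + w t /\<^sub>R 3) \<longlongrightarrow> V1) (at 0)"
    "((\<lambda>t. V t - w t) \<longlongrightarrow> V1) (at 0)" "((\<lambda>t. V (- t) + w t) \<longlongrightarrow> V1) (at 0)"
    using tendsto_diff[OF V_limits(3) w3] tendsto_add[OF V_limits(4) w3] tendsto_diff[OF V_limits(1) w]
      tendsto_add[OF V_limits(2) w] by simp_all
  have K: "(K1 \<longlongrightarrow> J0) (at 0)" "(K2 \<longlongrightarrow> J0) (at 0)" "(K3 \<longlongrightarrow> J0) (at 0)" "(K4 \<longlongrightarrow> J0) (at 0)"
    unfolding K1_def K2_def K3_def K4_def J0_def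
    by (intro tendsto_inverse V1_nonzero dl)+
  have Jl: "((\<lambda>t. J (3 * t)) \<longlongrightarrow> J0) (at 0)" "((\<lambda>t. J (- 3 * t)) \<longlongrightarrow> J0) (at 0)"
    "(J \<longlongrightarrow> J0) (at 0)" "((\<lambda>t. J (- t)) \<longlongrightarrow> J0) (at 0)"
    unfolding J_def J0_def by (intro tendsto_inverse V1_nonzero V_limits; simp add: V_limits)+
  \<comment> \<open>The part of the condition that does not contain the offset.\<close>
  define D where "D t = (J t - J (- t)) - (J (3 * t) - J (- 3 * t)) /\<^sub>R 3" for t
  \<comment> \<open>Replacing each correction by \<open>Z = J0 w J0\<close> costs at most \<open>\<bar>Z\<bar> / 4\<close>, so the remaining multiple of \<open>\<bar>Z\<bar>\<close> is at least \<open>16/9 - (20/9) / 4 > 1\<close>.\<close>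
  define \<eta> where "\<eta> = (norm J0)\<^sup>2 / 4"
  have \<eta>: "\<eta> > 0" using J0 by (simp add: \<eta>_def)
  have close: "\<forall>\<^sub>F t in at 0. norm (K t * w t * L t - J0 * w t * J0) \<le> \<eta> * norm (w t)"
    if "(K \<longlongrightarrow> J0) (at 0)" "(L \<longlongrightarrow> J0) (at 0)" for K L
  proof -
    have "((\<lambda>t. norm (K t - J0) * norm (L t) + norm J0 * norm (L t - J0))
        \<longlongrightarrow> norm (J0 - J0) * norm J0 + norm J0 * norm (J0 - J0)) (at 0)"
      by (intro tendsto_intros that)
    then have "\<forall>\<^sub>F t in at 0. norm (K t - J0) * norm (L t) + norm J0 * norm (L t - J0) < \<eta>"
      by (rule order_tendstoD) (simp add: \<eta>)
    then show ?thesis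
    proof eventually_elim
      case (elim t)
      have "K t * w t * L t - J0 * w t * J0 = (K t - J0) * w t * L t + J0 * w t * (L t - J0)"
        by (simp add: algebra_simps)
      then have "norm (K t * w t * L t - J0 * w t * J0)
          \<le> norm ((K t - J0) * w t * L t) + norm (J0 * w t * (L t - J0))"
        by (metis norm_triangle_ineq)
      also have "\<dots> = (norm (K t - J0) * norm (L t) + norm J0 * norm (L t - J0)) * norm (w t)"
        by (simp only: norm_mult) (simp add: algebra_simps)
      also have "\<dots> \<le> \<eta> * norm (w t)" using elim by (intro mult_right_mono) auto
      finally show ?case .
    qed
  qed
  have ne: "\<forall>\<^sub>F t in at 0. f t \<noteq> 0" if "(f \<longlongrightarrow> V1) (at 0)" for f :: "real \<Rightarrow> quat"
    using tendsto_imp_eventually_ne[OF that] V1_nonzero by simp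
  have "near 3 (\<lambda>t. J t - J (- t) - (2 * t) *\<^sub>R J1) 0"
    by (rule near_odd_part[OF J2])
  note odd = this near_scale_argument[OF this, of 3]
  \<comment> \<open>The linear terms \<open>2 t J1\<close> and \<open>6 t J1 / 3\<close> agree.\<close>
  have "near 3 (\<lambda>t. (J t - J (- t) - (2 * t) *\<^sub>R J1)
      - inverse 3 *\<^sub>R (J (3 * t) - J (- (3 * t)) - (2 * (3 * t)) *\<^sub>R J1)) (0 - inverse 3 *\<^sub>R 0)"
    by (intro near_diff near_scaleR_const odd) simp
  then have "near 3 D 0"
    unfolding D_def by (simp add: scaleR_diff_right)
  then obtain C where C: "\<forall>\<^sub>F t in at 0. norm (D t - 0) \<le> C * \<bar>t\<bar> ^ 3" by (rule nearE)
  have "\<forall>\<^sub>F t in at 0. norm (w t - 0) \<le> (C / (norm J0)\<^sup>2) * \<bar>t\<bar> ^ 3"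
    using C eq close[OF K(1) Jl(1)] close[OF K(2) Jl(2)] close[OF K(3) Jl(3)] close[OF K(4) Jl(4)]
      ne[OF dl(1)] ne[OF dl(2)] ne[OF dl(3)] ne[OF dl(4)]
      ne[OF V_limits(1)] ne[OF V_limits(2)] ne[OF V_limits(3)] ne[OF V_limits(4)]
  proof eventually_elim
    case (elim t)
    define Z where "Z = J0 * w t * J0"
    define M1 where "M1 = K1 t * w t * J (3 * t)"
    define M2 where "M2 = K2 t * w t * J (- 3 * t)"
    define M3 where "M3 = K3 t * w t * J t"
    define M4 where "M4 = K4 t * w t * J (- t)"
    have K: "K1 t = J (3 * t) + M1 /\<^sub>R 3" "K2 t = J (- 3 * t) - M2 /\<^sub>R 3"
      "K3 t = J t + M3" "K4 t = J (- t) - M4"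
      using elim inverse_difference[of "V (3 * t) - w t /\<^sub>R 3" "V (3 * t)"]
        inverse_difference[of "V (- 3 * t) + w t /\<^sub>R 3" "V (- 3 * t)"]
        inverse_difference[of "V t - w t" "V t"] inverse_difference[of "V (- t) + w t" "V (- t)"]
      by (simp_all add: K1_def K2_def K3_def K4_def J_def M1_def M2_def M3_def M4_def algebra_simps)
    have "(K1 t - K2 t) /\<^sub>R 3 = K3 t - K4 t"
      using elim(2) by (simp add: K1_def K2_def K3_def K4_def)
    then have "D t = (M1 + M2) /\<^sub>R 9 - (M3 + M4)"
      unfolding K D_def by (simp add: algebra_simps)
    also have "\<dots> = ((M1 - Z) + (M2 - Z)) /\<^sub>R 9 - ((M3 - Z) + (M4 - Z)) - (16 / 9) *\<^sub>R Z"
      by (simp add: vec_eq_iff quat_eq_iff field_simps)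
    finally have "(16 / 9) *\<^sub>R Z = ((M1 - Z) + (M2 - Z)) /\<^sub>R 9 - ((M3 - Z) + (M4 - Z)) - D t"
      by simp
    then have "norm ((16 / 9) *\<^sub>R Z) \<le> norm (((M1 - Z) + (M2 - Z)) /\<^sub>R 9) + norm ((M3 - Z) + (M4 - Z)) + norm (D t)"
      by (metis (no_types, opaque_lifting) norm_triangle_ineq4 order_trans add_right_mono)
    also have "\<dots> \<le> (norm (M1 - Z) + norm (M2 - Z)) / 9 + (norm (M3 - Z) + norm (M4 - Z)) + norm (D t)"
      using norm_triangle_ineq[of "M1 - Z" "M2 - Z"] norm_triangle_ineq[of "M3 - Z" "M4 - Z"]
      by (simp add: add_mono divide_right_mono)
    finally have "16 / 9 * norm Z \<le> (norm (M1 - Z) + norm (M2 - Z)) / 9 + (norm (M3 - Z) + norm (M4 - Z)) + norm (D t)"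
      by simp
    moreover have "norm (M1 - Z) \<le> \<eta> * norm (w t)" "norm (M2 - Z) \<le> \<eta> * norm (w t)"
      "norm (M3 - Z) \<le> \<eta> * norm (w t)" "norm (M4 - Z) \<le> \<eta> * norm (w t)"
      using elim(3-6) by (simp_all add: M1_def M2_def M3_def M4_def Z_def)
    moreover have "norm Z = 4 * (\<eta> * norm (w t))"
      by (simp add: Z_def norm_mult \<eta>_def power2_eq_square)
    moreover have "\<eta> * norm (w t) \<ge> 0" using \<eta> by simp
    ultimately have "norm Z \<le> norm (D t)" by argo
    then have "(norm J0)\<^sup>2 * norm (w t) \<le> C * \<bar>t\<bar> ^ 3"
      using elim(1) by (simp add: Z_def norm_mult power2_eq_square algebra_simps)
    then show ?case using J0 by (simp add: field_simps)
  qed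
  then show ?thesis by (rule nearI)
qed

text \<open>The half diagonals of the parallelogram are \<open>e = E / t\<close> and \<open>q = Q / (3 t)\<close>, so that \<open>E\<close> and \<open>Q\<close> have a limit.
  The four equations state that the vertices of the parallelogram invert to the vertices of the
  sampled curve, seen from \<open>p = s u + t w\<close>.\<close>

lemma parallelogram_expansion:
  obtains w P E Q :: "real \<Rightarrow> quat"
  where "near 3 w 0" "near 2 P J1" "near 2 E J0" "near 2 Q J0"
    "\<forall>\<^sub>F t in at 0. t \<noteq> 0 \<and> scal (w t) = 0 \<and> scal (P t) = 0 \<and> scal (E t) = 0 \<and> scal (Q t) = 0 \<and>
      inverse (P t - Q t /\<^sub>R (3 * t)) = - (3 * t) *\<^sub>R V (- 3 * t) - t *\<^sub>R w t \<and>
      inverse (P t - E t /\<^sub>R t) = - t *\<^sub>R V (- t) - t *\<^sub>R w t \<and>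
      inverse (P t + E t /\<^sub>R t) = t *\<^sub>R V t - t *\<^sub>R w t \<and>
      inverse (P t + Q t /\<^sub>R (3 * t)) = (3 * t) *\<^sub>R V (3 * t) - t *\<^sub>R w t"
proof -
  obtain w where w0: "(w \<longlongrightarrow> 0) (at 0)" and ev: "\<forall>\<^sub>F t in at 0. scal (w t) = 0 \<and>
      (inverse (V (3 * t) - w t /\<^sub>R 3) - inverse (V (- 3 * t) + w t /\<^sub>R 3)) /\<^sub>R 3
        = inverse (V t - w t) - inverse (V (- t) + w t)"
    by (rule fixed_point_exists)
  have w: "near 3 w 0"
    by (rule fixed_point_offset[OF w0]) (use ev in eventually_elim, simp)
  define J where "J t = inverse (V t)" for t
  obtain J2 where J2: "near 3 (\<lambda>t. J t - (J0 + t *\<^sub>R J1 + t\<^sup>2 *\<^sub>R J2)) 0"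
    using near_inverse_expansion[OF expansion V1_nonzero]
    unfolding J_def J0_def J1_def by metis
  have perturb: "near 3 (\<lambda>t. inverse (f t + w t /\<^sub>R c) - inverse (f t)) 0"
    if f: "(f \<longlongrightarrow> V1) (at 0)" for f :: "real \<Rightarrow> quat" and c :: real
  proof -
    have wc: "near 3 (\<lambda>t. - (w t /\<^sub>R c)) 0"
      using near_minus[OF near_scaleR_const[OF w, of "inverse c"]] by simp
    have g: "((\<lambda>t. f t + w t /\<^sub>R c) \<longlongrightarrow> V1) (at 0)"
      using tendsto_diff[OF f near_tendsto[OF wc]] by simp
    have "near (0 + (3 + 0)) (\<lambda>t. inverse (f t + w t /\<^sub>R c) * (- (w t /\<^sub>R c) * inverse (f t))) 0"
      by (intro bounded_bilinear.near_mult_zero[OF bounded_bilinear_mult] wc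
          tendsto_near_zero[OF tendsto_inverse[OF g V1_nonzero]]
          tendsto_near_zero[OF tendsto_inverse[OF f V1_nonzero]])
    then have "near 3 (\<lambda>t. inverse (f t + w t /\<^sub>R c) * (- (w t /\<^sub>R c) * inverse (f t))) 0"
      by simp
    then show ?thesis
    proof (rule near_cong)
      have "\<forall>\<^sub>F t in at 0. f t \<noteq> 0" "\<forall>\<^sub>F t in at 0. f t + w t /\<^sub>R c \<noteq> 0"
        using tendsto_imp_eventually_ne[OF f] tendsto_imp_eventually_ne[OF g] V1_nonzero by auto
      then show "\<forall>\<^sub>F t in at 0. inverse (f t + w t /\<^sub>R c) - inverse (f t)
          = inverse (f t + w t /\<^sub>R c) * (- (w t /\<^sub>R c) * inverse (f t))"
      proof eventually_elim
        case (elim t)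
        show ?case by (subst inverse_difference) (use elim in \<open>simp_all add: mult.assoc\<close>)
      qed
    qed
  qed
  define K1 where "K1 t = inverse (V (3 * t) - w t /\<^sub>R 3)" for t
  define K2 where "K2 t = inverse (V (- 3 * t) + w t /\<^sub>R 3)" for t
  define K3 where "K3 t = inverse (V t - w t)" for t
  define K4 where "K4 t = inverse (V (- t) + w t)" for t
  have K: "near 3 (\<lambda>t. K1 t - J (3 * t)) 0" "near 3 (\<lambda>t. K2 t - J (- 3 * t)) 0"
    "near 3 (\<lambda>t. K3 t - J t) 0" "near 3 (\<lambda>t. K4 t - J (- t)) 0"
    using perturb[OF V_limits(3), of "- 3"] perturb[OF V_limits(4), of 3]
      perturb[OF V_limits(1), of "- 1"] perturb[OF V_limits(2), of 1]
    by (simp_all add: K1_def K2_def K3_def K4_def J_def)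
  define P where "P t = (K3 t - K4 t) /\<^sub>R (2 * t)" for t
  define E where "E t = (K3 t + K4 t) /\<^sub>R 2" for t
  define Q where "Q t = (K1 t + K2 t) /\<^sub>R 2" for t
  have t0: "\<forall>\<^sub>F t in at (0::real). t \<noteq> 0" by (simp add: eventually_at_filter)
  have P: "near 2 P J1"
  proof -
    have "near (Suc 2) (\<lambda>t. inverse 2 *\<^sub>R ((K3 t - J t) - (K4 t - J (- t)) + (J t - J (- t) - (2 * t) *\<^sub>R J1)))
      (inverse 2 *\<^sub>R ((0 - 0) + 0))"
      using K near_odd_part[OF J2] by (intro near_scaleR_const near_add near_diff) simp_all
    then have "near 2 (\<lambda>t. (inverse 2 *\<^sub>R ((K3 t - J t) - (K4 t - J (- t)) + (J t - J (- t) - (2 * t) *\<^sub>R J1))) /\<^sub>R t) 0"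
      by (intro near_divide_argument) simp
    then have "near 2 (\<lambda>t. P t - J1) 0"
      by (rule near_cong) (use t0 in eventually_elim, simp add: P_def scaleR_diff_right)
    then show ?thesis by (simp flip: near_0_iff)
  qed
  note even = near_even_part[OF J2]
  have E: "near 2 E J0"
  proof -
    have "near 2 (\<lambda>t. inverse 2 *\<^sub>R ((K3 t - J t) + (K4 t - J (- t))) + (J t + J (- t)) /\<^sub>R 2)
        (inverse 2 *\<^sub>R (0 + 0) + J0)"
      using K by (intro near_scaleR_const near_add even) (auto intro: near_order_mono)
    then show ?thesis by (simp add: E_def[abs_def] algebra_simps)
  qed
  have Q: "near 2 Q J0"
  proof -
    have "near 2 (\<lambda>t. inverse 2 *\<^sub>R ((K1 t - J (3 * t)) + (K2 t - J (- 3 * t))) + (J (3 * t) + J (- (3 * t))) /\<^sub>R 2)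
        (inverse 2 *\<^sub>R (0 + 0) + J0)"
      using K by (intro near_scaleR_const near_add near_scale_argument[OF even]) (auto intro: near_order_mono)
    then show ?thesis by (simp add: Q_def[abs_def] algebra_simps)
  qed
  show ?thesis
  proof (rule that[OF w P E Q])
    show "\<forall>\<^sub>F t in at 0. t \<noteq> 0 \<and> scal (w t) = 0 \<and> scal (P t) = 0 \<and> scal (E t) = 0 \<and> scal (Q t) = 0 \<and>
      inverse (P t - Q t /\<^sub>R (3 * t)) = - (3 * t) *\<^sub>R V (- 3 * t) - t *\<^sub>R w t \<and>
      inverse (P t - E t /\<^sub>R t) = - t *\<^sub>R V (- t) - t *\<^sub>R w t \<and>
      inverse (P t + E t /\<^sub>R t) = t *\<^sub>R V t - t *\<^sub>R w t \<and>
      inverse (P t + Q t /\<^sub>R (3 * t)) = (3 * t) *\<^sub>R V (3 * t) - t *\<^sub>R w t"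
      using ev t0
    proof eventually_elim
      case (elim t)
      have im: "scal (K1 t) = 0" "scal (K2 t) = 0" "scal (K3 t) = 0" "scal (K4 t) = 0"
        using elim by (simp_all add: K1_def K2_def K3_def K4_def imaginary)
      have k: "(K1 t - K2 t) /\<^sub>R 3 = K3 t - K4 t"
        using elim by (simp only: K1_def K2_def K3_def K4_def)
      \<comment> \<open>By the parallelogram condition both diagonals have the midpoint \<open>P t\<close>.\<close>
      have P3: "P t = (K1 t - K2 t) /\<^sub>R (6 * t)"
        unfolding P_def k[symmetric] by simp
      have half: "x /\<^sub>R (2 * c) + x /\<^sub>R (2 * c) = x /\<^sub>R c" if "c \<noteq> 0" for x :: quat and c
        using that by (simp add: field_simps flip: scaleR_left_distrib)
      have PE: "P t + E t /\<^sub>R t = K3 t /\<^sub>R t" "P t - E t /\<^sub>R t = - (K4 t /\<^sub>R t)"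
        using half[of t] elim by (simp_all add: P_def E_def scaleR_diff_right scaleR_add_right field_simps)
      have PQ: "P t + Q t /\<^sub>R (3 * t) = K1 t /\<^sub>R (3 * t)" "P t - Q t /\<^sub>R (3 * t) = - (K2 t /\<^sub>R (3 * t))"
        unfolding P3
        using half[of "3 * t"] elim by (simp_all add: Q_def scaleR_diff_right scaleR_add_right field_simps)
      have inv: "inverse (x /\<^sub>R c) = c *\<^sub>R inverse x" for x :: quat and c
        by (simp add: inverse_scaleR_distrib)
      have Ki: "inverse (K1 t) = V (3 * t) - w t /\<^sub>R 3" "inverse (K2 t) = V (- 3 * t) + w t /\<^sub>R 3"
        "inverse (K3 t) = V t - w t" "inverse (K4 t) = V (- t) + w t"
        by (simp_all add: K1_def K2_def K3_def K4_def)
      have "scal (P t) = 0" "scal (E t) = 0" "scal (Q t) = 0"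
        using im by (simp_all add: P_def E_def Q_def)
      then show ?case
        unfolding PE PQ inverse_minus_eq inv Ki
        using elim by (simp add: scaleR_diff_right scaleR_add_right)
    qed
  qed
qed

end

section \<open>Convergence to the osculating circle\<close>

text \<open>With \<open>j0 = - v1 / \<bar>v1\<bar>\<^sup>2\<close>, the vector \<open>j1\<close> is a reflected copy of \<open>v2 / 2\<close>, scaled by a
  negative factor. The reflection preserves the component orthogonal to \<open>v1\<close>, so projecting away \<open>v1\<close> leaves the normal part of the
  acceleration, which is \<open>\<kappa> \<bar>v1\<bar>\<^sup>2 n\<close>.\<close>

lemma limit_circle:
  fixes v1 v2 :: "real^3"
  assumes v1: "v1 \<noteq> 0" and c: "cross3 v1 v2 \<noteq> 0"
  defines "j0 \<equiv> - (v1 /\<^sub>R (norm v1)\<^sup>2)"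
  defines "j1 \<equiv> vect (- (Imag j0 * Imag (v2 /\<^sub>R 2) * Imag j0))"
  defines "h \<equiv> j1 - ((j1 \<bullet> v1) / (v1 \<bullet> v1)) *\<^sub>R v1"
  defines "\<kappa> \<equiv> norm (cross3 v1 v2) / norm v1 ^ 3"
    and "n \<equiv> cross3 (cross3 v1 v2 /\<^sub>R norm (cross3 v1 v2)) (v1 /\<^sub>R norm v1)"
  shows "h = - (\<kappa> / 2) *\<^sub>R n" "norm n = 1"
proof -
  define b where "b = norm (cross3 v1 v2)"
  define a where "a = norm v1"
  have ab: "a > 0" "b > 0" using v1 c by (simp_all add: a_def b_def)
  have aa: "v1 \<bullet> v1 = a * a" by (simp add: a_def dot_square_norm power2_eq_square)
  have j1: "j1 = - (1 / (a * a)) *\<^sub>R (v2 /\<^sub>R 2) + (2 * (j0 \<bullet> (v2 /\<^sub>R 2))) *\<^sub>R j0"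
  proof -
    have "(norm j0)\<^sup>2 = 1 / (a * a)"
      using ab by (simp add: j0_def a_def[symmetric] power2_eq_square divide_simps)
    then show ?thesis
      unfolding j1_def
      using sandwich_imaginary[of "Imag j0" "Imag (v2 /\<^sub>R 2)"]
      by (simp add: norm_imaginary del: vect_quat_simps(7)) 
  qed
  have "n = (1 / (a * b)) *\<^sub>R cross3 (cross3 v1 v2) v1"
    by (simp add: n_def a_def b_def cross_mult_left cross_mult_right divide_inverse mult.commute)
  also have "cross3 (cross3 v1 v2) v1 = (a * a) *\<^sub>R v2 - (v1 \<bullet> v2) *\<^sub>R v1"
    by (subst cross_skew) (simp add: Lagrange aa)
  finally have n: "n = (1 / (a * b)) *\<^sub>R ((a * a) *\<^sub>R v2 - (v1 \<bullet> v2) *\<^sub>R v1)" .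
  define \<nu> where "\<nu> = v1 \<bullet> v2"
  have h: "h = (- 1 / (2 * a * a)) *\<^sub>R v2 + (\<nu> / (2 * a ^ 4)) *\<^sub>R v1"
    using ab unfolding h_def j1 j0_def a_def[symmetric]
    by (simp add: inner_diff_left inner_add_left aa \<nu>_def[symmetric] inner_commute[of v2 v1] vec_eq_iff
        power2_eq_square eval_nat_numeral field_simps)
  show "h = - (\<kappa> / 2) *\<^sub>R n"
    unfolding h n \<kappa>_def \<nu>_def[symmetric] a_def[symmetric] b_def[symmetric] using ab
    by (simp add: vec_eq_iff eval_nat_numeral field_simps)
  have "(cross3 v1 v2 /\<^sub>R norm (cross3 v1 v2)) \<bullet> (v1 /\<^sub>R norm v1) = 0" by simp
  then have "(norm n)\<^sup>2 = 1"
    unfolding n_def using norm_cross[of "cross3 v1 v2 /\<^sub>R norm (cross3 v1 v2)" "v1 /\<^sub>R norm v1"] v1 c by simp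
  then show "norm n = 1" by (simp add: power2_eq_1_iff) (metis norm_ge_zero not_one_le_zero le_minus_one_simps(3))
qed

lemma chord_quotient_of_curve:
  assumes "C_k_curve 4 s" "iter_deriv 1 s u \<noteq> 0"
  shows "chord_quotient (\<lambda>t. Imag ((s (u + t) - s u) /\<^sub>R t))
    (Imag (iter_deriv 1 s u)) (Imag (iter_deriv 2 s u /\<^sub>R 2)) (Imag (iter_deriv 3 s u /\<^sub>R 6))"
proof
  define v1 v2 v3 where "v1 = iter_deriv 1 s u" and "v2 = iter_deriv 2 s u" and "v3 = iter_deriv 3 s u"
  have "near (Suc 3) (\<lambda>t. s (u + t) - (s u + t *\<^sub>R v1 + (t ^ 2 / 2) *\<^sub>R v2 + (t ^ 3 / 6) *\<^sub>R v3)) 0"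
    using curve_taylor[OF assms(1), of u] by (simp add: v1_def v2_def v3_def)
  from near_divide_argument[OF this]
  have "near 3 (\<lambda>t. (s (u + t) - s u) /\<^sub>R t - (v1 + t *\<^sub>R (v2 /\<^sub>R 2) + t\<^sup>2 *\<^sub>R (v3 /\<^sub>R 6))) 0"
  proof (rule near_cong)
    have "\<forall>\<^sub>F t in at (0::real). t \<noteq> 0" by (simp add: eventually_at_filter)
    then show "\<forall>\<^sub>F t in at 0. (s (u + t) - s u) /\<^sub>R t - (v1 + t *\<^sub>R (v2 /\<^sub>R 2) + t\<^sup>2 *\<^sub>R (v3 /\<^sub>R 6))
      = (s (u + t) - (s u + t *\<^sub>R v1 + (t ^ 2 / 2) *\<^sub>R v2 + (t ^ 3 / 6) *\<^sub>R v3)) /\<^sub>R t"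
      by eventually_elim (simp add: vec_eq_iff power2_eq_square power3_eq_cube field_simps)
  qed
  from bounded_linear.near[OF bounded_linear_Imag this]
  have "near 3 (\<lambda>t. Imag ((s (u + t) - s u) /\<^sub>R t - (v1 + t *\<^sub>R (v2 /\<^sub>R 2) + t\<^sup>2 *\<^sub>R (v3 /\<^sub>R 6)))) 0"
    by (simp add: linear_simps[OF bounded_linear_Imag] del: scaleR_scaleR)
  then show "near 3 (\<lambda>t. Imag ((s (u + t) - s u) /\<^sub>R t) -
      (Imag (iter_deriv 1 s u) + t *\<^sub>R Imag (iter_deriv 2 s u /\<^sub>R 2) + t\<^sup>2 *\<^sub>R Imag (iter_deriv 3 s u /\<^sub>R 6))) 0"
    by (rule near_cong) (simp add: v1_def v2_def v3_def quat_eq_iff)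
qed (use assms in \<open>simp_all add: quat_eq_iff\<close>)

text \<open>All ingredients converge with error \<open>O(\<epsilon>\<^sup>2)\<close>, and \<open>h\<close> depends on them through sums, products and
  inverses of nonzero limits. The direction of the inverted line is scaled by \<open>3 \<epsilon> \<bar>\<epsilon>\<bar>\<close> to make it converge
  to a multiple of the tangent.\<close>

lemma discrete_curvature_expansion:
  assumes C: "C_k_curve 4 s" and reg: "iter_deriv 1 s u \<noteq> 0" and curv: "curvature s u \<noteq> 0"
  obtains p :: "real \<Rightarrow> real^3"
  where "near 3 p (s u)" "\<forall>\<^sub>F \<epsilon> in at 0. p_bc (sample s u \<epsilon>) 0 = Some (Imag (p \<epsilon>))"
    "near 2 (\<lambda>\<epsilon>. discrete_curvature (sample s u \<epsilon>) 0) (curvature s u)"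
    "near 2 (\<lambda>\<epsilon>. curvature_center (sample s u \<epsilon>) 0) (s u + (1 / curvature s u) *\<^sub>R principal_normal s u)"
proof -
  define v1 v2 where "v1 = iter_deriv 1 s u" and "v2 = iter_deriv 2 s u"
  define V where "V t = Imag ((s (u + t) - s u) /\<^sub>R t)" for t
  interpret chord_quotient V "Imag v1" "Imag (v2 /\<^sub>R 2)" "Imag (iter_deriv 3 s u /\<^sub>R 6)"
    unfolding V_def v1_def v2_def by (rule chord_quotient_of_curve[OF C reg])
  obtain w P E Q :: "real \<Rightarrow> quat"
    where w: "near 3 w 0" and P: "near 2 P J1" and E: "near 2 E J0" and Q: "near 2 Q J0"
    and ev: "\<forall>\<^sub>F t in at 0. t \<noteq> 0 \<and> scal (w t) = 0 \<and> scal (P t) = 0 \<and> scal (E t) = 0 \<and> scal (Q t) = 0 \<and>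
      inverse (P t - Q t /\<^sub>R (3 * t)) = - (3 * t) *\<^sub>R V (- 3 * t) - t *\<^sub>R w t \<and>
      inverse (P t - E t /\<^sub>R t) = - t *\<^sub>R V (- t) - t *\<^sub>R w t \<and>
      inverse (P t + E t /\<^sub>R t) = t *\<^sub>R V t - t *\<^sub>R w t \<and>
      inverse (P t + Q t /\<^sub>R (3 * t)) = (3 * t) *\<^sub>R V (3 * t) - t *\<^sub>R w t"
    by (rule parallelogram_expansion)
  define d where "d t = vect (norm (Q t) *\<^sub>R E t + norm (E t) *\<^sub>R Q t)" for t
  define h where "h t = vect (P t) - ((vect (P t) \<bullet> d t) / (d t \<bullet> d t)) *\<^sub>R d t" for t
  define p where "p t = s u + t *\<^sub>R vect (w t)" for t
  define \<kappa> where "\<kappa> = curvature s u"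
  define n where "n = principal_normal s u"
  have v1: "v1 \<noteq> 0" and cr: "cross3 v1 v2 \<noteq> 0" and \<kappa>: "\<kappa> > 0"
    using reg curv by (auto simp: v1_def v2_def \<kappa>_def curvature_def)
  define d0 where "d0 = vect ((2 * norm J0) *\<^sub>R J0)"
  define h0 where "h0 = vect J1 - ((vect J1 \<bullet> d0) / (d0 \<bullet> d0)) *\<^sub>R d0"
  have J0_vect: "vect J0 = - (v1 /\<^sub>R (norm v1)\<^sup>2)" and J0_Imag: "J0 = Imag (- (v1 /\<^sub>R (norm v1)\<^sup>2))"
    by (simp_all add: J0_def quat_eq_iff norm_imaginary)
  define k where "k = - (2 * norm J0 * inverse ((norm v1)\<^sup>2))"
  have d0_v1: "d0 = k *\<^sub>R v1" and k: "k \<noteq> 0"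
    using v1 J0 by (simp_all add: d0_def k_def J0_vect)
  have h0_v1: "h0 = vect J1 - ((vect J1 \<bullet> v1) / (v1 \<bullet> v1)) *\<^sub>R v1"
    using k by (simp add: h0_def d0_v1)
  have \<kappa>_v1: "\<kappa> = norm (cross3 v1 v2) / norm v1 ^ 3"
    and n_v1: "n = cross3 (cross3 v1 v2 /\<^sub>R norm (cross3 v1 v2)) (v1 /\<^sub>R norm v1)"
    by (simp_all only: \<kappa>_def curvature_def n_def principal_normal_def unit_binormal_def
        unit_tangent_def Let_def v1_def v2_def)
  have h0: "h0 = - (\<kappa> / 2) *\<^sub>R n" and n: "norm n = 1"
    unfolding h0_v1 \<kappa>_v1 n_v1 J1_def J0_Imag by (rule limit_circle[OF v1 cr])+
  have norm_h0: "norm h0 = \<kappa> / 2" using \<kappa> n by (simp add: h0)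
  have d: "near 2 d d0"
    unfolding d_def[abs_def] d0_def
    using near_add[OF near_scaleR[OF near_norm[OF Q] E] near_scaleR[OF near_norm[OF E] Q]]
    by (intro bounded_linear.near[OF bounded_linear_vect])
      (simp only: mult_2 scaleR_left_distrib)
  have d0: "d0 \<noteq> 0" using k v1 by (simp add: d0_v1)
  have h: "near 2 h h0"
    unfolding h_def[abs_def] h0_def divide_inverse
    by (intro near_diff near_scaleR near_mult near_inner near_inverse d
        bounded_linear.near[OF bounded_linear_vect P]) (use d0 in simp_all)
  have h0_nz: "h0 \<noteq> 0" using norm_h0 \<kappa> by auto
  have p: "near 3 p (s u)"
  proof -
    have "near (1 + 3) (\<lambda>t. t *\<^sub>R vect (w t)) 0"
      using near_power[of 1] bounded_linear.near[OF bounded_linear_vect w]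
      by (intro bounded_bilinear.near_mult_zero[OF bounded_bilinear_scaleR]) simp_all
    then have "near 3 (\<lambda>t. t *\<^sub>R vect (w t)) 0" by (rule near_order_mono) simp
    from near_add[OF near_const this] show ?thesis by (simp add: p_def[abs_def])
  qed
  have E_lim: "(E \<longlongrightarrow> J0) (at 0)" and Q_lim: "(Q \<longlongrightarrow> J0) (at 0)"
    using near_tendsto[OF E] near_tendsto[OF Q] by simp_all
  have "((\<lambda>t. norm (E t) - norm (Q t) / 3) \<longlongrightarrow> norm J0 - norm J0 / 3) (at 0)"
    by (intro tendsto_intros E_lim Q_lim) simp
  then have ev_norm: "\<forall>\<^sub>F t in at 0. norm (E t) - norm (Q t) / 3 > 0"
    by (rule order_tendstoD) (use J0 in simp)
  have w_lim: "(w \<longlongrightarrow> 0) (at 0)" using near_tendsto[OF w] by simp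
  have lims: "((\<lambda>t. 3 *\<^sub>R V (- 3 * t) + w t) \<longlongrightarrow> 3 *\<^sub>R Imag v1) (at 0)"
    "((\<lambda>t. V (- t) + w t) \<longlongrightarrow> Imag v1) (at 0)"
    "((\<lambda>t. V t - w t) \<longlongrightarrow> Imag v1) (at 0)"
    "((\<lambda>t. 3 *\<^sub>R V (3 * t) - w t) \<longlongrightarrow> 3 *\<^sub>R Imag v1) (at 0)"
    using tendsto_add[OF tendsto_scaleR[OF tendsto_const V_limits(4)] w_lim, of 3]
      tendsto_add[OF V_limits(2) w_lim] tendsto_diff[OF V_limits(1) w_lim]
      tendsto_diff[OF tendsto_scaleR[OF tendsto_const V_limits(3)] w_lim, of 3] by simp_all
  have three: "3 *\<^sub>R Imag v1 \<noteq> 0" using V1_nonzero by simp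
  have "\<forall>\<^sub>F t in at 0. Q t \<noteq> 0" "\<forall>\<^sub>F t in at 0. d t \<noteq> 0" "\<forall>\<^sub>F t in at 0. h t \<noteq> 0"
    "\<forall>\<^sub>F t in at 0. 3 *\<^sub>R V (- 3 * t) + w t \<noteq> 0" "\<forall>\<^sub>F t in at 0. V (- t) + w t \<noteq> 0"
    "\<forall>\<^sub>F t in at 0. V t - w t \<noteq> 0" "\<forall>\<^sub>F t in at 0. 3 *\<^sub>R V (3 * t) - w t \<noteq> 0"
    using tendsto_imp_eventually_ne[OF Q_lim J0(1)] tendsto_imp_eventually_ne[OF near_tendsto[OF d] d0]
      tendsto_imp_eventually_ne[OF near_tendsto[OF h] h0_nz]
      tendsto_imp_eventually_ne[OF lims(1) three] tendsto_imp_eventually_ne[OF lims(2) V1_nonzero]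
      tendsto_imp_eventually_ne[OF lims(3) V1_nonzero] tendsto_imp_eventually_ne[OF lims(4) three]
    by (simp_all only: zero_less_numeral)
  with ev ev_norm
  have exact: "\<forall>\<^sub>F t in at 0. p_bc (sample s u t) 0 = Some (Imag (p t)) \<and>
      curvature_center (sample s u t) 0 = p t - h t /\<^sub>R (2 * (norm (h t))\<^sup>2) \<and>
      discrete_curvature (sample s u t) 0 = 2 * norm (h t)"
  proof eventually_elim
    case (elim t)
    then have t: "t \<noteq> 0" and im: "scal (w t) = 0" "scal (P t) = 0" "scal (E t) = 0" "scal (Q t) = 0"
      and inv: "inverse (P t - Q t /\<^sub>R (3 * t)) = - (3 * t) *\<^sub>R V (- 3 * t) - t *\<^sub>R w t"
      "inverse (P t - E t /\<^sub>R t) = - t *\<^sub>R V (- t) - t *\<^sub>R w t"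
      "inverse (P t + E t /\<^sub>R t) = t *\<^sub>R V t - t *\<^sub>R w t"
      "inverse (P t + Q t /\<^sub>R (3 * t)) = (3 * t) *\<^sub>R V (3 * t) - t *\<^sub>R w t"
      by blast+
    have V': "x *\<^sub>R V x = Imag (s (u + x) - s u)" for x
      by (cases "x = 0") (simp_all add: V_def quat_eq_iff)
    have vertices: "Imag (sample s u t (0 - 1)) = Imag (p t) + inverse (P t - Q t /\<^sub>R (3 * t))"
      "Imag (sample s u t 0) = Imag (p t) + inverse (P t - E t /\<^sub>R t)"
      "Imag (sample s u t (0 + 1)) = Imag (p t) + inverse (P t + E t /\<^sub>R t)"
      "Imag (sample s u t (0 + 2)) = Imag (p t) + inverse (P t + Q t /\<^sub>R (3 * t))"
      unfolding inv using V'[of "- 3 * t"] V'[of "- t"] V'[of t] V'[of "3 * t"] im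
      by (simp_all add: sample_def p_def quat_eq_iff)
    have inv': "inverse (P t - Q t /\<^sub>R (3 * t)) = - (t *\<^sub>R (3 *\<^sub>R V (- 3 * t) + w t))"
      "inverse (P t - E t /\<^sub>R t) = - (t *\<^sub>R (V (- t) + w t))"
      "inverse (P t + E t /\<^sub>R t) = t *\<^sub>R (V t - w t)"
      "inverse (P t + Q t /\<^sub>R (3 * t)) = t *\<^sub>R (3 *\<^sub>R V (3 * t) - w t)"
      unfolding inv by (simp_all add: scaleR_add_right scaleR_diff_right mult.commute)
    have nz: "P t + E t /\<^sub>R t \<noteq> 0" "P t - E t /\<^sub>R t \<noteq> 0" "P t + Q t /\<^sub>R (3 * t) \<noteq> 0"
      "P t - Q t /\<^sub>R (3 * t) \<noteq> 0"
      using inv' elim t by (metis inverse_zero neg_equal_0_iff_equal scaleR_eq_0_iff)+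
    have norms: "norm (Q t /\<^sub>R (3 * t)) = inverse (3 * \<bar>t\<bar>) * norm (Q t)"
      "norm (E t /\<^sub>R t) = inverse \<bar>t\<bar> * norm (E t)"
      by (simp_all add: abs_mult)
    have dd: "vect (norm (Q t /\<^sub>R (3 * t)) *\<^sub>R (E t /\<^sub>R t) + norm (E t /\<^sub>R t) *\<^sub>R (Q t /\<^sub>R (3 * t)))
        = inverse (3 * t * \<bar>t\<bar>) *\<^sub>R d t"
    proof -
      have coeffs: "inverse (3 * \<bar>t\<bar>) * a * inverse t = inverse (3 * t * \<bar>t\<bar>) * a"
        "inverse \<bar>t\<bar> * a * inverse (3 * t) = inverse (3 * t * \<bar>t\<bar>) * a" for a
        by (simp_all only: inverse_mult_distrib ac_simps)
      show ?thesis
        unfolding norms scaleR_scaleR coeffs d_def vect_quat_simps scaleR_add_right ..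
    qed
    have ne: "Q t /\<^sub>R (3 * t) \<noteq> 0" using elim t by simp
    have lt: "norm (Q t /\<^sub>R (3 * t)) < norm (E t /\<^sub>R t)"
    proof -
      have "norm (Q t) / 3 < norm (E t)" using elim by linarith
      then have "inverse \<bar>t\<bar> * (norm (Q t) / 3) < inverse \<bar>t\<bar> * norm (E t)"
        using t by (intro mult_strict_left_mono) simp_all
      then show ?thesis unfolding norms by simp
    qed
    have c0: "inverse (3 * t * \<bar>t\<bar>) \<noteq> 0" using t by simp
    have "d t \<noteq> 0" "h t \<noteq> 0" using elim by auto
    note exact = discrete_curvature_parallelogram[OF _ _ _ _ ne lt nz vertices dd c0 this(1) h_def this(2)]
    show ?case
      using exact im by simp
  qed
  show ?thesis
  proof (rule that[OF p])
    show "\<forall>\<^sub>F \<epsilon> in at 0. p_bc (sample s u \<epsilon>) 0 = Some (Imag (p \<epsilon>))"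
      using exact by eventually_elim simp
    have "near 2 (\<lambda>t. 2 * norm (h t)) (2 * norm h0)"
      by (intro near_mult near_norm h near_const)
    then have "near 2 (\<lambda>t. 2 * norm (h t)) (curvature s u)"
      unfolding norm_h0 \<kappa>_def by simp
    then show "near 2 (\<lambda>\<epsilon>. discrete_curvature (sample s u \<epsilon>) 0) (curvature s u)"
      by (rule near_cong) (use exact in eventually_elim, simp)
    have "near 2 (\<lambda>t. p t - h t /\<^sub>R (2 * (norm (h t))\<^sup>2)) (s u - h0 /\<^sub>R (2 * (norm h0)\<^sup>2))"
      unfolding power2_eq_square
      by (intro near_diff near_scaleR near_inverse near_mult near_norm h near_const near_order_mono[OF p])
        (use h0_nz in simp_all)
    also have "s u - h0 /\<^sub>R (2 * (norm h0)\<^sup>2) = s u + (1 / \<kappa>) *\<^sub>R n"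
      unfolding norm_h0 unfolding h0 using \<kappa> by (simp add: power2_eq_square field_simps)
    finally have "near 2 (\<lambda>t. p t - h t /\<^sub>R (2 * (norm (h t))\<^sup>2))
        (s u + (1 / curvature s u) *\<^sub>R principal_normal s u)"
      unfolding \<kappa>_def n_def .
    then show "near 2 (\<lambda>\<epsilon>. curvature_center (sample s u \<epsilon>) 0)
        (s u + (1 / curvature s u) *\<^sub>R principal_normal s u)"
      by (rule near_cong) (use exact in eventually_elim, simp)
  qed
qed

theorem theorem28:
  shows "\<exists>k. \<forall>(s :: real \<Rightarrow> real^3) (u :: real).
    C_k_curve k s \<and> regular_curve s \<and> curvature s u \<noteq> 0 \<longrightarrow>
      (\<lambda>\<epsilon>. discrete_curvature (sample s u \<epsilon>) 0 - \<bar>curvature s u\<bar>) \<in> O[at 0](\<lambda>\<epsilon>. \<epsilon> ^ 2) \<and>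
      (\<lambda>\<epsilon>. norm (curvature_center (sample s u \<epsilon>) 0
              - (s u + (1 / curvature s u) *\<^sub>R principal_normal s u))) \<in> O[at 0](\<lambda>\<epsilon>. \<epsilon> ^ 2) \<and>
      (\<exists>P. (\<forall>\<^sub>F \<epsilon> in at 0. p_bc (sample s u \<epsilon>) 0 = Some (Imag (P \<epsilon>))) \<and>
           (\<lambda>\<epsilon>. norm (P \<epsilon> - s u)) \<in> O[at 0](\<lambda>\<epsilon>. \<epsilon> ^ 3))"
proof (intro exI[of _ 4] allI impI)
  fix s :: "real \<Rightarrow> real^3" and u :: real
  assume *: "C_k_curve 4 s \<and> regular_curve s \<and> curvature s u \<noteq> 0"
  then have "C_k_curve 4 s" "iter_deriv 1 s u \<noteq> 0" "curvature s u \<noteq> 0"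
    by (simp_all add: regular_curve_def)
  then obtain p :: "real \<Rightarrow> real^3" where p: "near 3 p (s u)"
    "\<forall>\<^sub>F \<epsilon> in at 0. p_bc (sample s u \<epsilon>) 0 = Some (Imag (p \<epsilon>))"
    and c: "near 2 (\<lambda>\<epsilon>. discrete_curvature (sample s u \<epsilon>) 0) (curvature s u)"
    and m: "near 2 (\<lambda>\<epsilon>. curvature_center (sample s u \<epsilon>) 0) (s u + (1 / curvature s u) *\<^sub>R principal_normal s u)"
    by (rule discrete_curvature_expansion)
  have "curvature s u \<ge> 0" by (simp add: curvature_def)
  then have "(\<lambda>\<epsilon>. discrete_curvature (sample s u \<epsilon>) 0 - \<bar>curvature s u\<bar>) \<in> O[at 0](\<lambda>\<epsilon>. \<epsilon> ^ 2)"
    using near_bigo[OF c] by simp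
  then show "(\<lambda>\<epsilon>. discrete_curvature (sample s u \<epsilon>) 0 - \<bar>curvature s u\<bar>) \<in> O[at 0](\<lambda>\<epsilon>. \<epsilon> ^ 2) \<and>
      (\<lambda>\<epsilon>. norm (curvature_center (sample s u \<epsilon>) 0
              - (s u + (1 / curvature s u) *\<^sub>R principal_normal s u))) \<in> O[at 0](\<lambda>\<epsilon>. \<epsilon> ^ 2) \<and>
      (\<exists>P. (\<forall>\<^sub>F \<epsilon> in at 0. p_bc (sample s u \<epsilon>) 0 = Some (Imag (P \<epsilon>))) \<and>
           (\<lambda>\<epsilon>. norm (P \<epsilon> - s u)) \<in> O[at 0](\<lambda>\<epsilon>. \<epsilon> ^ 3))"
    using near_bigo[OF m] p(2) near_bigo[OF p(1)] by blast
qed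

end
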